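(* Let $k$ be an even non-negative integer, and let $\chi_1,\chi_2$ be primitive Dirichlet characters modulo $p$ and $q$ respectively, such that one of them is a non-principal even character and the other is an odd character. Let $a,x>0$. Then for every complex $\nu$ with $\Re(\nu)>0$, \begin{align*} \sum_{n=1}^\infty \sigma_{k,\chi_1,\chi_2}(n)n^{\frac{\nu}{2}}K_\nu(a\sqrt{nx})=\frac{(-1)^{\frac{k}{2}} (aq)^{\nu} p^{\nu+k} x^{\frac{\nu}{2}}}{i\,2^{3\nu+k+2}\pi^{2\nu+k+1}} \tau(\chi_1)\tau(\chi_2) \Gamma(\nu+k+1)\sum_{n=1}^\infty \frac{\sigma_{k,\bar{\chi}_2,\bar{\chi}_1}(n)}{\left( n+\frac{a^2pqx}{16\pi^2} \right)^{\nu+k+1} } . \end{align*}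
   Context: For Dirichlet characters $\chi_1,\chi_2$ and $z\in\mathbb{C}$: $\sigma_{z,\chi_1,\chi_2}(n)=\sum_{d\mid n}d^z\chi_1(d)\chi_2(n/d)$. $\tau(\chi)=\sum_{h=1}^q\chi(h)e^{2\pi i h/q}$ is the Gauss sum, and $K_\nu$ the modified Bessel function of the second kind. *)

theory Defs
  imports "HOL-Analysis.Analysis"
begin

text \<open>Dirichlet characters modulo q, represented on the naturals; chi(-1) is chi(q-1).\<close>
definition dirichlet_char :: "nat \<Rightarrow> (nat \<Rightarrow> complex) \<Rightarrow> bool" where
  "dirichlet_char q chi \<longleftrightarrow> q > 0 \<and>
     (\<forall>m n. chi (m * n) = chi m * chi n) \<and>
     (\<forall>n. chi (n + q) = chi n) \<and>
     (\<forall>n. chi n \<noteq> 0 \<longleftrightarrow> coprime n q)"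

definition primitive_char :: "nat \<Rightarrow> (nat \<Rightarrow> complex) \<Rightarrow> bool" where
  "primitive_char q chi \<longleftrightarrow> dirichlet_char q chi \<and>
     (\<forall>d. d dvd q \<and> d < q \<longrightarrow>
        \<not> (\<forall>n. coprime n q \<and> n mod d = 1 mod d \<longrightarrow> chi n = 1))"

definition principal_char :: "nat \<Rightarrow> (nat \<Rightarrow> complex) \<Rightarrow> bool" where
  "principal_char q chi \<longleftrightarrow> (\<forall>n. coprime n q \<longrightarrow> chi n = 1)"

definition even_char :: "nat \<Rightarrow> (nat \<Rightarrow> complex) \<Rightarrow> bool" where
  "even_char q chi \<longleftrightarrow> chi (q - 1) = 1"

definition odd_char :: "nat \<Rightarrow> (nat \<Rightarrow> complex) \<Rightarrow> bool" where
  "odd_char q chi \<longleftrightarrow> chi (q - 1) = -1"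

definition sigma_chi :: "complex \<Rightarrow> (nat \<Rightarrow> complex) \<Rightarrow> (nat \<Rightarrow> complex) \<Rightarrow> nat \<Rightarrow> complex" where
  "sigma_chi z chi1 chi2 n = (\<Sum>d | d dvd n. of_nat d powr z * chi1 d * chi2 (n div d))"

definition gauss_sum :: "nat \<Rightarrow> (nat \<Rightarrow> complex) \<Rightarrow> complex" where
  "gauss_sum q chi = (\<Sum>h=1..q. chi h * exp (2 * of_real pi * \<i> * of_nat h / of_nat q))"

definition besselK :: "complex \<Rightarrow> real \<Rightarrow> complex" where
  "besselK \<nu> x = (LBINT t:{0..}. of_real (exp (- x * cosh t)) * cosh (\<nu> * of_real t))"

end

theory Submission
  imports Defs "HOL-Number_Theory.Number_Theory"
begin

text \<open>
  Since \<^term>\<open>besselK \<nu>\<close> is a Laplace-type integral, the left-hand series is an integral transform of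
  \<open>F(y) = \<Sum> \<sigma>(n) e\<^sup>-\<^sup>n\<^sup>y\<close>, an Eisenstein series of weight \<open>k + 1\<close> without constant term, while the
  right-hand series is, by Euler's integral for \<open>\<Gamma>\<close>, the same kind of transform of the series \<open>G\<close> attached
  to the pair of conjugate characters. The theorem is therefore the transformation law relating \<open>F(y)\<close> to
  \<open>G(4\<pi>\<^sup>2/(pqy))\<close>, integrated against \<open>exp (- e\<^sup>v) e\<^bsup>\<nu>v\<^esup>\<close> over the real line.

  For the transformation law, sum over one divisor by a Lipschitz formula (obtained from the reflection
  formula of the digamma function and its derivatives), which expresses both \<open>F\<close> and \<open>G\<close> as iterated sums of
  \<open>\<chi>\<^sub>2(m) cnj \<chi>\<^sub>1(n) / (my \<plusminus> 2\<pi>in/p)\<^bsup>k+1\<^esup>\<close>, in opposite orders. In weight one this double series is not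
  absolutely convergent. However, both characters have mean zero, so that grouping the terms into
  \<open>q \<times> p\<close> blocks turns the summand into a mixed second difference, which decays two powers faster; the
  block sums converge absolutely and the order of summation can be exchanged for every \<open>k\<close>.
\<close>

section \<open>Dirichlet characters and Gauss sums\<close>

lemma primitive_imp_dirichlet: "primitive_char q chi \<Longrightarrow> dirichlet_char q chi"
  by (simp add: primitive_char_def)

context
  fixes q :: nat and chi :: "nat \<Rightarrow> complex"
  assumes chi: "dirichlet_char q chi"
begin

lemma dirichlet_char_modulus_pos: "q > 0"
  using chi by (simp add: dirichlet_char_def)

lemma dirichlet_char_mult: "chi (m * n) = chi m * chi n"
  using chi by (simp add: dirichlet_char_def)

lemma dirichlet_char_eq_0_iff: "chi n = 0 \<longleftrightarrow> \<not> coprime n q"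
  using chi unfolding dirichlet_char_def by blast

lemma dirichlet_char_1: "chi 1 = 1"
  using dirichlet_char_mult[of 1 1] dirichlet_char_eq_0_iff[of 1] by simp

lemma dirichlet_char_add_mult: "chi (j * q + n) = chi n"
proof (induction j)
  case (Suc j)
  have "chi (j * q + n + q) = chi (j * q + n)"
    using chi by (simp add: dirichlet_char_def)
  with Suc show ?case by (simp add: algebra_simps)
qed simp

lemma dirichlet_char_mod: "chi (n mod q) = chi n"
  using dirichlet_char_add_mult[of "n div q" "n mod q"] by simp

lemma dirichlet_char_cong: "[m = n] (mod q) \<Longrightarrow> chi m = chi n"
  unfolding cong_def by (metis dirichlet_char_mod)

lemma dirichlet_char_power: "chi (n ^ j) = chi n ^ j"
  by (induction j) (use dirichlet_char_1 in \<open>simp_all add: dirichlet_char_mult\<close>)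

lemma dirichlet_char_norm: "coprime n q \<Longrightarrow> norm (chi n) = 1"
proof -
  assume n: "coprime n q"
  have "chi n ^ totient q = chi (n ^ totient q)"
    by (simp add: dirichlet_char_power)
  also have "\<dots> = 1"
    using dirichlet_char_cong[OF euler_theorem[OF n]] dirichlet_char_1 by simp
  finally have "norm (chi n) ^ totient q = 1"
    by (metis norm_power norm_one)
  moreover have "totient q > 0"
    using dirichlet_char_modulus_pos by simp
  ultimately show ?thesis
    using power_eq_iff_eq_base[of "totient q" "norm (chi n)" 1] by simp
qed

lemma dirichlet_char_norm_le: "norm (chi n) \<le> 1"
  using dirichlet_char_norm[of n] dirichlet_char_eq_0_iff[of n] by (cases "coprime n q") simp_all

lemma dirichlet_char_mult_cnj: "coprime n q \<Longrightarrow> chi n * cnj (chi n) = 1"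
  using dirichlet_char_norm[of n] by (simp flip: complex_norm_square)

lemma dirichlet_char_cnj: "dirichlet_char q (cnj \<circ> chi)"
  using chi unfolding dirichlet_char_def by simp

lemma dirichlet_char_0: "q > 1 \<Longrightarrow> chi 0 = 0"
  by (simp add: dirichlet_char_eq_0_iff)

lemma dirichlet_char_reflect:
  assumes "n \<le> q" shows "chi (q - n) = chi (q - 1) * chi n"
proof -
  have "[q - n = (q - 1) * n] (mod q)"
  proof -
    have "int (q - n) = int q - int n" "int ((q - 1) * n) = (int q - 1) * int n"
      using assms dirichlet_char_modulus_pos by (auto simp: of_nat_diff)
    moreover have "[int q - int n = (int q - 1) * int n] (mod int q)"
      by (simp add: cong_iff_dvd_diff algebra_simps)
    ultimately show ?thesis
      by (metis cong_int_iff)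
  qed
  thus ?thesis using dirichlet_char_cong dirichlet_char_mult by metis
qed

lemma bij_betw_mult_mod:
  assumes "coprime a q"
  shows "bij_betw (\<lambda>n. a * n mod q) {..<q} {..<q}"
proof -
  have "inj_on (\<lambda>n. a * n mod q) {..<q}"
  proof (rule inj_onI)
    fix m n assume "m \<in> {..<q}" "n \<in> {..<q}" "a * m mod q = a * n mod q"
    moreover from this have "[m = n] (mod q)"
      using cong_mult_lcancel_nat[OF assms] by (simp add: cong_def)
    ultimately show "m = n" by (simp add: cong_def)
  qed
  moreover have "(\<lambda>n. a * n mod q) ` {..<q} \<subseteq> {..<q}"
    using dirichlet_char_modulus_pos by auto
  ultimately show ?thesis
    by (simp add: bij_betw_def endo_inj_surj)
qed

lemma sum_residues_mult:
  assumes "coprime a q" "\<And>n. f (n mod q) = f n"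
  shows "(\<Sum>n<q. f (a * n)) = (\<Sum>n<q. f n :: complex)"
  using sum.reindex_bij_betw[OF bij_betw_mult_mod[OF assms(1)], of f] by (simp add: assms(2))

lemma dirichlet_char_sum_eq_0:
  assumes "\<not> principal_char q chi"
  shows "(\<Sum>n<q. chi n) = 0"
proof -
  obtain a where a: "coprime a q" "chi a \<noteq> 1"
    using assms by (auto simp: principal_char_def)
  have "chi a * (\<Sum>n<q. chi n) = (\<Sum>n<q. chi (a * n))"
    by (simp add: sum_distrib_left dirichlet_char_mult)
  also have "\<dots> = (\<Sum>n<q. chi n)"
    by (rule sum_residues_mult[OF a(1)]) (rule dirichlet_char_mod)
  finally show ?thesis using a(2) by simp
qed

lemma nonprincipal_modulus_gt_1:
  assumes "\<not> principal_char q chi" shows "q > 1"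
proof (rule ccontr)
  assume "\<not> q > 1"
  with dirichlet_char_modulus_pos have q: "q = 1" by simp
  hence "chi n = 1" for n
    using dirichlet_char_mod[of n] dirichlet_char_mod[of 1] dirichlet_char_1 by simp
  thus False using assms by (simp add: principal_char_def)
qed

lemma odd_char_not_principal:
  assumes "odd_char q chi" shows "\<not> principal_char q chi"
proof
  assume "principal_char q chi"
  moreover have "chi (q - 1) \<noteq> 0"
    using assms by (simp add: odd_char_def)
  ultimately have "chi (q - 1) = 1"
    by (simp add: principal_char_def dirichlet_char_eq_0_iff)
  thus False using assms by (simp add: odd_char_def)
qed

lemma sum_residues_from_1:
  assumes "q > 1"
  shows "(\<Sum>n<q. chi n * f n) = (\<Sum>n\<in>{1..<q}. chi n * f n)"
proof -
  have "{..<q} = insert 0 {1..<q}" using assms by auto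
  thus ?thesis using dirichlet_char_0[OF assms] by simp
qed

end

definition root_of_unity_exp :: "nat \<Rightarrow> nat \<Rightarrow> complex" where
  "root_of_unity_exp q n = exp (2 * of_real pi * \<i> * of_nat n / of_nat q)"

lemma root_of_unity_exp_add: "root_of_unity_exp q (m + n) = root_of_unity_exp q m * root_of_unity_exp q n"
  by (simp add: root_of_unity_exp_def add_divide_distrib distrib_left exp_add)

lemma root_of_unity_exp_modulus_mult: "q > 0 \<Longrightarrow> root_of_unity_exp q (j * q) = 1"
proof -
  assume "q > 0"
  have "root_of_unity_exp q (j * q) = exp (of_nat j * (2 * of_real pi * \<i>))"
    using \<open>q > 0\<close> by (simp add: root_of_unity_exp_def field_simps)
  also have "\<dots> = 1" by (simp add: exp_of_nat_mult)
  finally show ?thesis .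
qed

lemma root_of_unity_exp_mod: "q > 0 \<Longrightarrow> root_of_unity_exp q (n mod q) = root_of_unity_exp q n"
  using root_of_unity_exp_add[of q "n div q * q" "n mod q"] root_of_unity_exp_modulus_mult[of q "n div q"] by simp

lemma root_of_unity_exp_mult_mod:
  "q > 0 \<Longrightarrow> root_of_unity_exp q (m * (n mod q)) = root_of_unity_exp q (m * n)"
  by (metis root_of_unity_exp_mod mod_mult_right_eq)

lemma root_of_unity_exp_power: "root_of_unity_exp q n ^ m = root_of_unity_exp q (m * n)"
  by (simp add: root_of_unity_exp_def mult_ac flip: exp_of_nat_mult)

lemma root_of_unity_exp_eq_1_iff:
  assumes "q > 0"
  shows "root_of_unity_exp q n = 1 \<longleftrightarrow> q dvd n"
proof -
  have "root_of_unity_exp q n = 1 \<longleftrightarrow> (\<exists>j::int. 2 * pi * real n / real q = real_of_int (2 * j) * pi)"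
    by (simp add: root_of_unity_exp_def exp_eq_1 Re_divide_of_nat Im_divide_of_nat)
  also have "\<dots> \<longleftrightarrow> (\<exists>j::int. real_of_int (int n) = real_of_int (int q * j))"
    using assms by (simp add: field_simps)
  also have "\<dots> \<longleftrightarrow> int q dvd int n"
    unfolding of_int_eq_iff dvd_def by blast
  finally show ?thesis by simp
qed

lemma gauss_sum_conv:
  assumes "dirichlet_char q chi"
  shows "gauss_sum q chi = (\<Sum>h<q. chi h * root_of_unity_exp q h)"
proof -
  have q: "q > 0" using assms by (rule dirichlet_char_modulus_pos)
  have "gauss_sum q chi = (\<Sum>h\<in>{1..q}. chi h * root_of_unity_exp q h)"
    by (simp add: gauss_sum_def root_of_unity_exp_def)
  also have "\<dots> = (\<Sum>h\<in>insert q {1..<q}. chi h * root_of_unity_exp q h)"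
    using q by (intro sum.cong) auto
  also have "\<dots> = chi q * root_of_unity_exp q q + (\<Sum>h\<in>{1..<q}. chi h * root_of_unity_exp q h)"
    by simp
  also have "chi q * root_of_unity_exp q q = chi 0 * root_of_unity_exp q 0"
    using dirichlet_char_mod[OF assms, of q] root_of_unity_exp_mod[OF q, of q] by simp
  also have "chi 0 * root_of_unity_exp q 0 + (\<Sum>h\<in>{1..<q}. chi h * root_of_unity_exp q h)
      = (\<Sum>h\<in>insert 0 {1..<q}. chi h * root_of_unity_exp q h)" by simp
  also have "insert 0 {1..<q} = {..<q}" using q by auto
  finally show ?thesis .
qed

lemma gauss_sum_separable:
  assumes prim: "primitive_char q chi"
  shows "(\<Sum>n<q. chi n * root_of_unity_exp q (h * n)) = cnj (chi h) * gauss_sum q chi"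
proof -
  note chi = primitive_imp_dirichlet[OF prim]
  have q: "q > 0" using chi by (rule dirichlet_char_modulus_pos)
  let ?e = "root_of_unity_exp q"
  let ?S = "\<Sum>n<q. chi n * ?e (h * n)"
  show ?thesis
  proof (cases "coprime h q")
    case True
    have "chi h * ?S = (\<Sum>n<q. chi (h * n) * ?e (h * n))"
      by (simp add: sum_distrib_left dirichlet_char_mult[OF chi] mult_ac)
    also have "\<dots> = (\<Sum>n<q. chi n * ?e n)"
      by (rule sum_residues_mult[OF chi True])
         (simp add: dirichlet_char_mod[OF chi] root_of_unity_exp_mod[OF q])
    also have "\<dots> = gauss_sum q chi"
      by (rule gauss_sum_conv[OF chi, symmetric])
    finally have "cnj (chi h) * gauss_sum q chi = (chi h * cnj (chi h)) * ?S"
      by (simp add: mult_ac)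
    thus ?thesis using dirichlet_char_mult_cnj[OF chi True] by simp
  next
    case False
    define d where "d = q div gcd h q"
    have g: "gcd h q > 1"
      using False q by (metis coprime_iff_gcd_eq_1 gcd_pos_nat less_one nat_neq_iff not_gr_zero)
    have qd: "q = d * gcd h q" by (simp add: d_def)
    have d: "d dvd q" "d < q"
      using g q unfolding d_def by (auto simp: div_dvd_iff_mult)
    then obtain a where a: "coprime a q" "a mod d = 1 mod d" "chi a \<noteq> 1"
      using prim unfolding primitive_char_def by blast
    have e: "?e (h * (a * n)) = ?e (h * n)" for n
    proof -
      have "[gcd h q * a = gcd h q * 1] (mod (gcd h q * d))"
        using a(2) by (intro cong_cmult_leftI) (simp add: cong_def)
      hence "[(h div gcd h q * n) * (gcd h q * a) = (h div gcd h q * n) * (gcd h q * 1)] (mod (d * gcd h q))"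
        unfolding mult.commute[of d] by (rule cong_scalar_left)
      moreover have "(h div gcd h q * n) * (gcd h q * a) = (h div gcd h q * gcd h q) * (a * n)"
        "(h div gcd h q * n) * (gcd h q * 1) = (h div gcd h q * gcd h q) * n"
        by (simp_all only: mult_ac mult_1_right)
      ultimately have "[h * (a * n) = h * n] (mod q)"
        unfolding qd[symmetric] by (simp only: dvd_div_mult_self gcd_dvd1)
      hence "(h * (a * n)) mod q = (h * n) mod q"
        by (simp add: cong_def)
      thus ?thesis using root_of_unity_exp_mod[OF q] by metis
    qed
    have "chi a * ?S = (\<Sum>n<q. chi (a * n) * ?e (h * (a * n)))"
      unfolding e sum_distrib_left by (simp add: dirichlet_char_mult[OF chi] mult_ac)
    also have "\<dots> = (\<Sum>n<q. chi n * ?e (h * n))"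
      by (rule sum_residues_mult[OF chi a(1)])
         (simp add: dirichlet_char_mod[OF chi] root_of_unity_exp_mult_mod[OF q])
    finally have "?S = 0" using a(3) by simp
    thus ?thesis using False dirichlet_char_eq_0_iff[OF chi] by simp
  qed
qed

lemma sum_root_of_unity_exp:
  assumes "q > 0"
  shows "(\<Sum>h<q. root_of_unity_exp q (h * m)) = (if q dvd m then of_nat q else 0)"
proof -
  have "(\<Sum>h<q. root_of_unity_exp q (h * m)) = (\<Sum>h<q. root_of_unity_exp q m ^ h)"
    by (simp add: root_of_unity_exp_power)
  also have "\<dots> = (if q dvd m then of_nat q else 0)"
  proof (cases "q dvd m")
    case True
    hence "root_of_unity_exp q m = 1" using root_of_unity_exp_eq_1_iff[OF assms] by simp
    thus ?thesis using True by simp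
  next
    case False
    hence "root_of_unity_exp q m \<noteq> 1" using root_of_unity_exp_eq_1_iff[OF assms] by simp
    moreover have "root_of_unity_exp q m ^ q = 1"
      using root_of_unity_exp_modulus_mult[OF assms, of m] by (simp add: root_of_unity_exp_power mult.commute)
    ultimately show ?thesis using False by (simp add: geometric_sum)
  qed
  finally show ?thesis .
qed

lemma primitive_char_fourier:
  assumes prim: "primitive_char q chi"
  shows "chi n = gauss_sum q chi / of_nat q * (\<Sum>h<q. cnj (chi h) * root_of_unity_exp q ((q - h) * n))"
proof -
  note chi = primitive_imp_dirichlet[OF prim]
  have q: "q > 0" using chi by (rule dirichlet_char_modulus_pos)
  let ?e = "root_of_unity_exp q"
  have "gauss_sum q chi * (\<Sum>h<q. cnj (chi h) * ?e ((q - h) * n))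
      = (\<Sum>h<q. (\<Sum>m<q. chi m * ?e (h * m)) * ?e ((q - h) * n))"
    by (simp add: gauss_sum_separable[OF prim] sum_distrib_left mult_ac)
  also have "\<dots> = (\<Sum>m<q. chi m * (\<Sum>h<q. ?e (h * m + (q - h) * n)))"
    unfolding sum_distrib_left sum_distrib_right root_of_unity_exp_add
    by (subst sum.swap) (simp add: mult_ac)
  also have "\<dots> = (\<Sum>m<q. chi m * (\<Sum>h<q. ?e (h * (m + (q - n mod q)))))"
  proof (intro sum.cong refl, rule arg_cong[where f = "\<lambda>x. _ * x"], intro sum.cong refl)
    fix m h assume "h \<in> {..<q}"
    have "[h * m + (q - h) * n = h * (m + (q - n mod q))] (mod q)"
    proof -
      have "[h * m + (q - h) * n = h * m + (q - h) * (n mod q)] (mod q)"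
        by (intro cong_add cong_mult cong_refl) (simp add: cong_def)
      moreover have "h * (m + (q - n mod q)) + q * (n mod q) = h * m + (q - h) * (n mod q) + q * h"
      proof -
        have *: "int (q - n mod q) = int q - int (n mod q)" "int (q - h) = int q - int h"
          using q \<open>h \<in> {..<q}\<close> by (auto simp: of_nat_diff)
        have "int (h * (m + (q - n mod q)) + q * (n mod q)) = int (h * m + (q - h) * (n mod q) + q * h)"
          unfolding of_nat_add of_nat_mult * by (simp only: algebra_simps)
        thus ?thesis unfolding of_nat_eq_iff .
      qed
      ultimately show ?thesis
        by (metis cong_def mod_mult_self2)
    qed
    thus "?e (h * m + (q - h) * n) = ?e (h * (m + (q - n mod q)))"
      using root_of_unity_exp_mod[OF q] by (metis cong_def)
  qed
  also have "\<dots> = (\<Sum>m<q. if m = n mod q then chi m * of_nat q else 0)"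
  proof (intro sum.cong refl)
    fix m assume m: "m \<in> {..<q}"
    have "q dvd m + (q - n mod q) \<longleftrightarrow> m = n mod q"
    proof
      assume "q dvd m + (q - n mod q)"
      then obtain c where c: "m + (q - n mod q) = q * c" by (auto elim: dvdE)
      have r: "n mod q < q" using q by simp
      hence "0 < q * c" "q * c < q * 2" using m unfolding c[symmetric] by (simp_all add: trans_less_add2)
      hence "c = 1" using q by auto
      thus "m = n mod q" using c r by simp
    next
      assume "m = n mod q"
      thus "q dvd m + (q - n mod q)" using q by (simp add: less_imp_le)
    qed
    thus "chi m * (\<Sum>h<q. ?e (h * (m + (q - n mod q)))) = (if m = n mod q then chi m * of_nat q else 0)"
      unfolding sum_root_of_unity_exp[OF q] by simp
  qed
  also have "\<dots> = chi n * of_nat q"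
    using q by (simp add: dirichlet_char_mod[OF chi])
  finally show ?thesis using q by (simp add: field_simps)
qed

lemma gauss_sum_mult_cnj:
  assumes prim: "primitive_char q chi"
  shows "gauss_sum q chi * gauss_sum q (cnj \<circ> chi) = chi (q - 1) * of_nat q"
proof -
  note chi = primitive_imp_dirichlet[OF prim]
  have q: "q > 0" using chi by (rule dirichlet_char_modulus_pos)
  let ?e = "root_of_unity_exp q"
  have co: "coprime (q - 1) q"
    using q by (metis coprime_diff_one_left_nat)
  have inv: "?e ((q - 1) * h) * ?e h = 1" for h
  proof -
    have "(q - 1) * h + h = h * q" using q by (cases q) simp_all
    thus ?thesis
      using root_of_unity_exp_modulus_mult[OF q, of h] by (simp flip: root_of_unity_exp_add)
  qed
  have e: "?e (q - h) = ?e ((q - 1) * h)" if "h < q" for h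
  proof -
    have "?e (q - h) * ?e h = 1"
      using that root_of_unity_exp_modulus_mult[OF q, of 1] by (simp flip: root_of_unity_exp_add)
    with inv show ?thesis by (metis mult_cancel_right mult_zero_right zero_neq_one)
  qed
  have ee: "?e ((q - 1) * ((q - 1) * h)) = ?e h" for h
    using inv[of "(q - 1) * h"] inv[of h]
    by (metis mult.commute mult_cancel_right mult_zero_right zero_neq_one)
  have "1 = chi 1" using dirichlet_char_1[OF chi] by simp
  also have "\<dots> = gauss_sum q chi / of_nat q * (\<Sum>h<q. cnj (chi h) * ?e ((q - h) * 1))"
    by (rule primitive_char_fourier[OF prim])
  also have "(\<Sum>h<q. cnj (chi h) * ?e ((q - h) * 1)) = (\<Sum>h<q. cnj (chi h) * ?e ((q - 1) * h))"
    by (intro sum.cong) (auto simp: e)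
  also have "\<dots> = (\<Sum>h<q. cnj (chi ((q - 1) * h)) * ?e ((q - 1) * ((q - 1) * h)))"
    by (rule sum_residues_mult[OF chi co, symmetric])
       (simp add: dirichlet_char_mod[OF chi] root_of_unity_exp_mult_mod[OF q])
  also have "\<dots> = cnj (chi (q - 1)) * gauss_sum q (cnj \<circ> chi)"
    unfolding ee gauss_sum_conv[OF dirichlet_char_cnj[OF chi]] sum_distrib_left
    by (simp add: dirichlet_char_mult[OF chi] mult_ac)
  finally have *: "of_nat q = cnj (chi (q - 1)) * (gauss_sum q chi * gauss_sum q (cnj \<circ> chi))"
    using q by (simp add: field_simps)
  have "chi (q - 1) * of_nat q =
      (chi (q - 1) * cnj (chi (q - 1))) * (gauss_sum q chi * gauss_sum q (cnj \<circ> chi))"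
    unfolding * by (simp only: mult.assoc)
  also have "\<dots> = gauss_sum q chi * gauss_sum q (cnj \<circ> chi)"
    unfolding dirichlet_char_mult_cnj[OF chi co] by simp
  finally show ?thesis ..
qed

section \<open>A twisted Lipschitz formula\<close>

lemma summable_power_coeff:
  fixes z :: complex
  assumes "norm z < 1"
  shows "summable (\<lambda>n. of_nat (Suc n) ^ k * z ^ Suc n)"
proof -
  have "summable (\<lambda>n. (if n = 0 then 0 else of_nat n ^ k) * z ^ n)"
    using assms
  proof (induction k arbitrary: z)
    case 0
    have "summable (\<lambda>n. z ^ Suc n)"
      using 0 by (simp add: summable_geometric summable_mult)
    thus ?case by (subst summable_Suc_iff[symmetric]) simp
  next
    case (Suc k)
    have "summable (\<lambda>n. diffs (\<lambda>n. if n = 0 then 0 else of_nat n ^ k) n * z ^ n)"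
      by (rule termdiff_converges[OF Suc.prems]) (rule Suc.IH)
    hence "summable (\<lambda>n. z * (diffs (\<lambda>n. if n = 0 then 0 else of_nat n ^ k) n * z ^ n))"
      by (rule summable_mult)
    hence "summable (\<lambda>n. of_nat (Suc n) ^ Suc k * z ^ Suc n)"
      by (simp add: diffs_def mult_ac)
    thus ?case by (subst summable_Suc_iff[symmetric]) simp
  qed
  thus ?thesis by (subst (asm) summable_Suc_iff[symmetric]) simp
qed

lemma has_field_derivative_power_coeff:
  fixes z :: complex
  assumes "norm z < 1"
  shows "((\<lambda>z. \<Sum>n. of_nat (Suc n) ^ k * z ^ Suc n) has_field_derivative
           (\<Sum>n. of_nat (Suc n) ^ Suc k * z ^ n)) (at z)"
proof -
  define c :: "nat \<Rightarrow> complex" where "c = (\<lambda>n. if n = 0 then 0 else of_nat n ^ k)"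
  have c: "summable (\<lambda>n. c n * y ^ n)" if "norm y < 1" for y
    using summable_power_coeff[OF that, of k] by (subst summable_Suc_iff[symmetric]) (simp add: c_def)
  obtain K :: real where K: "norm z < K" "K < 1" using dense[OF assms] by blast
  have "((\<lambda>z. \<Sum>n. c n * z ^ n) has_field_derivative (\<Sum>n. diffs c n * z ^ n)) (at z)"
    by (rule termdiffs_strong[of c "of_real K"]) (use K c[of "of_real K"] le_less_trans[OF norm_ge_zero K(1)] in auto)
  moreover have "(\<lambda>n. diffs c n * z ^ n) = (\<lambda>n. of_nat (Suc n) ^ Suc k * z ^ n)"
    by (simp add: diffs_def c_def)
  ultimately have "((\<lambda>z. \<Sum>n. c n * z ^ n) has_field_derivative
           (\<Sum>n. of_nat (Suc n) ^ Suc k * z ^ n)) (at z)" by simp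
  moreover have "(\<Sum>n. c n * y ^ n) = (\<Sum>n. of_nat (Suc n) ^ k * y ^ Suc n)" if "norm y < 1" for y
    using suminf_split_head[OF c[OF that]] by (simp add: c_def)
  moreover have "open (ball (0::complex) 1)" by simp
  ultimately show ?thesis
    using assms
    by (elim has_field_derivative_transform_within_open[where S = "ball 0 1"]) auto
qed

lemma Digamma_reflection:
  fixes u :: complex
  assumes "Im u \<noteq> 0"
  shows "Digamma (1 - u) - Digamma u = of_real pi * cos (of_real pi * u) / sin (of_real pi * u)"
proof -
  have notint: "v \<notin> \<int>\<^sub>\<le>\<^sub>0" if "Im v \<noteq> 0" for v :: complex
    using that by (auto simp: nonpos_Ints_def)
  have sin: "sin (of_real pi * v) \<noteq> 0" if "Im v \<noteq> 0" for v :: complex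
  proof
    assume "sin (of_real pi * v) = 0"
    then obtain n :: int where "of_real pi * v = of_real (real_of_int n * pi)"
      by (auto simp: sin_eq_0)
    hence "Im (of_real pi * v) = 0" by simp
    thus False using that by simp
  qed
  have "((\<lambda>u. Gamma u * Gamma (1 - u)) has_field_derivative
          Gamma u * Digamma u * Gamma (1 - u) + Gamma u * - (Gamma (1 - u) * Digamma (1 - u))) (at u)"
    using notint[of u] notint[of "1 - u"] assms
    by (auto intro!: derivative_eq_intros)
  moreover have "((\<lambda>u. of_real pi / sin (of_real pi * u)) has_field_derivative
      - (of_real pi * (cos (of_real pi * u) * of_real pi)) / (sin (of_real pi * u))\<^sup>2) (at u)"
    using sin[OF assms] by (auto intro!: derivative_eq_intros simp: power2_eq_square)
  ultimately have "Gamma u * Digamma u * Gamma (1 - u) + Gamma u * - (Gamma (1 - u) * Digamma (1 - u)) =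
      - (of_real pi * (cos (of_real pi * u) * of_real pi)) / (sin (of_real pi * u))\<^sup>2"
    unfolding Gamma_reflection_complex by (rule DERIV_unique)
  hence "(Gamma u * Gamma (1 - u)) * (Digamma (1 - u) - Digamma u) =
      of_real pi / sin (of_real pi * u) * (of_real pi * cos (of_real pi * u) / sin (of_real pi * u))"
    by (simp add: algebra_simps power2_eq_square)
  thus ?thesis
    using sin[OF assms] unfolding Gamma_reflection_complex by (subst (asm) mult_left_cancel) auto
qed

lemma suminf_power_exp_Polygamma:
  fixes u :: complex
  assumes "Im u > 0"
  shows "(\<Sum>n. of_nat (Suc n) ^ k * exp (2 * of_real pi * \<i> * u) ^ Suc n) =
    (if k = 0 then - 1 / 2 else 0) + \<i> / (2 * of_real pi) / (2 * of_real pi * \<i>) ^ k *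
      ((-1) ^ k * Polygamma k (1 - u) - Polygamma k u)"
  using assms
proof (induction k arbitrary: u)
  case 0
  define z where "z = exp (\<i> * of_real pi * u)"
  have z2: "exp (2 * of_real pi * \<i> * u) = z\<^sup>2"
    by (simp add: z_def power2_eq_square mult_ac flip: exp_add)
  have z0: "z \<noteq> 0" by (simp add: z_def)
  have nz: "norm (z\<^sup>2) < 1"
    using 0 by (simp flip: z2)
  hence z1: "z\<^sup>2 \<noteq> 1" by auto
  have "(\<Sum>n. of_nat (Suc n) ^ 0 * exp (2 * of_real pi * \<i> * u) ^ Suc n) = z\<^sup>2 * (\<Sum>n. (z\<^sup>2) ^ n)"
    unfolding z2 by (simp add: suminf_mult[OF summable_geometric[OF nz]])
  also have "\<dots> = z\<^sup>2 / (1 - z\<^sup>2)"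
    by (simp add: suminf_geometric[OF nz])
  also have "\<dots> = - 1 / 2 + \<i> / 2 * (cos (of_real pi * u) / sin (of_real pi * u))"
  proof -
    have c: "cos (of_real pi * u) = (z + 1 / z) / 2" "sin (of_real pi * u) = (z - 1 / z) / (2 * \<i>)"
      by (simp_all add: cos_exp_eq sin_exp_eq z_def exp_minus field_simps mult_ac)
    have "z - 1 / z \<noteq> 0" using z1 z0 by (simp add: field_simps power2_eq_square)
    have cot: "cos (of_real pi * u) / sin (of_real pi * u) = \<i> * (z\<^sup>2 + 1) / (z\<^sup>2 - 1)"
      unfolding c using z0 z1 \<open>z - 1 / z \<noteq> 0\<close> by (simp add: field_simps power2_eq_square)
    show ?thesis unfolding cot using z1 by (simp add: divide_simps) (simp add: algebra_simps)
  qed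
  also have "cos (of_real pi * u) / sin (of_real pi * u) = (Digamma (1 - u) - Digamma u) / of_real pi"
    using Digamma_reflection[of u] 0 by simp
  finally show ?case by simp
next
  case (Suc k)
  define f where "f = (\<lambda>u. \<Sum>n. of_nat (Suc n) ^ k * exp (2 * of_real pi * \<i> * u) ^ Suc n)"
  define c where "c = \<i> / (2 * of_real pi) / (2 * of_real pi * \<i>) ^ k"
  have notint: "v \<notin> \<int>\<^sub>\<le>\<^sub>0" if "Im v \<noteq> 0" for v :: complex
    using that by (auto simp: nonpos_Ints_def)
  have nz: "norm (exp (2 * of_real pi * \<i> * u)) < 1"
    using Suc.prems by simp
  have "(f has_field_derivative (\<Sum>n. of_nat (Suc n) ^ Suc k * exp (2 * of_real pi * \<i> * u) ^ n) *
          (exp (2 * of_real pi * \<i> * u) * (2 * of_real pi * \<i>))) (at u)"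
    unfolding f_def
    by (rule DERIV_chain2[where f = "\<lambda>z. \<Sum>n. of_nat (Suc n) ^ k * z ^ Suc n"
              and g = "\<lambda>u. exp (2 * of_real pi * \<i> * u)"])
       (rule has_field_derivative_power_coeff[OF nz], auto intro!: derivative_eq_intros)
  moreover have "(f has_field_derivative c * ((-1) ^ k * - Polygamma (Suc k) (1 - u) - Polygamma (Suc k) u)) (at u)"
  proof (rule has_field_derivative_transform_within_open)
    show "((\<lambda>u. (if k = 0 then - 1 / 2 else 0) + c * ((-1) ^ k * Polygamma k (1 - u) - Polygamma k u))
        has_field_derivative c * ((-1) ^ k * - Polygamma (Suc k) (1 - u) - Polygamma (Suc k) u)) (at u)"
      using notint[of u] notint[of "1 - u"] Suc.prems
      by (auto intro!: derivative_eq_intros)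
    show "open {u. Im u > 0}" by (simp add: open_halfspace_Im_gt)
  qed (use Suc in \<open>auto simp: f_def c_def\<close>)
  ultimately have "(\<Sum>n. of_nat (Suc n) ^ Suc k * exp (2 * of_real pi * \<i> * u) ^ n) *
          (exp (2 * of_real pi * \<i> * u) * (2 * of_real pi * \<i>)) =
        c * ((-1) ^ k * - Polygamma (Suc k) (1 - u) - Polygamma (Suc k) u)"
    by (rule DERIV_unique)
  moreover have "(\<Sum>n. of_nat (Suc n) ^ Suc k * exp (2 * of_real pi * \<i> * u) ^ Suc n) =
     exp (2 * of_real pi * \<i> * u) * (\<Sum>n. of_nat (Suc n) ^ Suc k * exp (2 * of_real pi * \<i> * u) ^ n)"
  proof -
    let ?z = "exp (2 * of_real pi * \<i> * u)"
    have "summable (\<lambda>n. of_nat (Suc n) ^ Suc k * ?z ^ Suc n / ?z)"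
      by (intro summable_divide summable_power_coeff nz)
    hence "summable (\<lambda>n. of_nat (Suc n) ^ Suc k * ?z ^ n)" by (simp add: mult_ac)
    from suminf_mult[OF this, of ?z] show ?thesis by (simp add: mult_ac)
  qed
  ultimately have "(\<Sum>n. of_nat (Suc n) ^ Suc k * exp (2 * of_real pi * \<i> * u) ^ Suc n) * (2 * of_real pi * \<i>)
     = c * ((-1) ^ Suc k * Polygamma (Suc k) (1 - u) - Polygamma (Suc k) u)"
    by (simp add: mult_ac)
  hence "(\<Sum>n. of_nat (Suc n) ^ Suc k * exp (2 * of_real pi * \<i> * u) ^ Suc n)
     = c / (2 * of_real pi * \<i>) * ((-1) ^ Suc k * Polygamma (Suc k) (1 - u) - Polygamma (Suc k) u)"
    by (simp add: divide_simps del: power_Suc)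
  thus ?case by (simp add: c_def field_simps)
qed

lemma Polygamma_diff_sums:
  fixes z w :: complex
  assumes "z \<noteq> 0" "w \<noteq> 0"
  shows "(\<lambda>j. 1 / (z + of_nat j) ^ Suc k - 1 / (w + of_nat j) ^ Suc k) sums
           ((-1) ^ Suc k * (Polygamma k z - Polygamma k w) / fact k)"
proof (cases "k = 0")
  case True
  have "(\<lambda>m. (of_real (ln (real m)) - (\<Sum>n<m. inverse (w + of_nat n))) -
         (of_real (ln (real m)) - (\<Sum>n<m. inverse (z + of_nat n)))) \<longlonglongrightarrow> Digamma w - Digamma z"
    by (intro tendsto_diff Digamma_LIMSEQ assms)
  thus ?thesis using True by (simp add: sums_def sum_subtractf inverse_eq_divide)
next
  case False
  have "(\<lambda>j. inverse ((z + of_nat j) ^ Suc k) - inverse ((w + of_nat j) ^ Suc k)) sums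
      ((-1) ^ Suc k * Polygamma k z / fact k - (-1) ^ Suc k * Polygamma k w / fact k)"
    by (intro sums_diff Polygamma_LIMSEQ) (use assms False in auto)
  thus ?thesis by (simp add: inverse_eq_divide field_simps)
qed

lemma sum_Polygamma_sums:
  fixes c :: "'a \<Rightarrow> complex" and z :: "'a \<Rightarrow> complex"
  assumes "finite A" "(\<Sum>h\<in>A. c h) = 0" "\<And>h. h \<in> A \<Longrightarrow> z h \<noteq> 0"
  shows "(\<lambda>j. \<Sum>h\<in>A. c h / (z h + of_nat j) ^ Suc k) sums
           ((-1) ^ Suc k * (\<Sum>h\<in>A. c h * Polygamma k (z h)) / fact k)"
proof -
  have "(\<lambda>j. \<Sum>h\<in>A. c h * (1 / (z h + of_nat j) ^ Suc k - 1 / (1 + of_nat j) ^ Suc k)) sums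
      (\<Sum>h\<in>A. c h * ((-1) ^ Suc k * (Polygamma k (z h) - Polygamma k 1) / fact k))"
    by (intro sums_sum sums_mult Polygamma_diff_sums assms) auto
  also have "(\<lambda>j. \<Sum>h\<in>A. c h * (1 / (z h + of_nat j) ^ Suc k - 1 / (1 + of_nat j) ^ Suc k)) =
      (\<lambda>j. (\<Sum>h\<in>A. c h / (z h + of_nat j) ^ Suc k) - (\<Sum>h\<in>A. c h) / (1 + of_nat j) ^ Suc k)"
    by (simp add: right_diff_distrib sum_subtractf sum_divide_distrib)
  also have "(\<Sum>h\<in>A. c h * ((-1) ^ Suc k * (Polygamma k (z h) - Polygamma k 1) / fact k)) =
      (-1) ^ Suc k * ((\<Sum>h\<in>A. c h * Polygamma k (z h)) - (\<Sum>h\<in>A. c h) * Polygamma k 1) / fact k"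
    unfolding sum_distrib_right sum_subtractf[symmetric] sum_distrib_left sum_divide_distrib
    by (intro sum.cong refl) (simp add: algebra_simps)
  finally show ?thesis by (simp add: assms(2))
qed

definition lipschitz_kernel :: "nat \<Rightarrow> complex \<Rightarrow> real \<Rightarrow> real \<Rightarrow> complex" where
  "lipschitz_kernel k \<epsilon> a b = 1 / Complex a b ^ Suc k + \<epsilon> / Complex a (-b) ^ Suc k"

lemma twisted_lipschitz:
  fixes w :: real and k :: nat
  assumes prim: "primitive_char p chi" and np: "\<not> principal_char p chi" and w: "w > 0"
  defines "f \<equiv> (\<lambda>n. chi (Suc n) * of_nat (Suc n) ^ k * of_real (exp (- (real (Suc n) * w))))"
  shows "summable f"
    and "(\<lambda>j. fact k * gauss_sum p chi / of_nat p * (\<Sum>h\<in>{1..<p}. cnj (chi h) *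
            lipschitz_kernel k (cnj (chi (p - 1))) w (2 * pi * real (j * p + h) / real p))) sums (\<Sum>n. f n)"
proof -
  note chi = primitive_imp_dirichlet[OF prim]
  have p: "p > 1" using nonprincipal_modulus_gt_1[OF chi np] .
  let ?\<tau> = "gauss_sum p chi" and ?\<epsilon> = "cnj (chi (p - 1))"
  define v where "v = \<i> * of_real (w / (2 * pi))"
  \<comment> \<open>The representative \<open>p - h\<close> of \<open>- h\<close> makes both \<open>u h\<close> and \<open>1 - u h\<close> start their
    Polygamma series at the first block.\<close>
  define u where "u = (\<lambda>h. v + of_nat (p - h) / of_nat p)"
  have Imv: "Im v = w / (2 * pi)"
    by (simp add: v_def del: of_real_divide)
  have Imu: "Im (u h) > 0" for h
    using w by (simp add: u_def Imv Im_divide_of_nat)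
  have expu: "exp (2 * of_real pi * \<i> * u h) ^ Suc n =
      of_real (exp (- (real (Suc n) * w))) * root_of_unity_exp p ((p - h) * Suc n)" for h n
  proof -
    have "exp (2 * of_real pi * \<i> * u h) = exp (of_real (-w)) * root_of_unity_exp p (p - h)"
      unfolding root_of_unity_exp_def exp_add[symmetric]
      by (rule arg_cong[where f = exp]) (simp add: u_def v_def field_simps)
    also have "\<dots> ^ Suc n = exp (of_real (-w)) ^ Suc n * root_of_unity_exp p (Suc n * (p - h))"
      unfolding power_mult_distrib root_of_unity_exp_power ..
    also have "exp (of_real (-w)) ^ Suc n = complex_of_real (exp (- (real (Suc n) * w)))"
      unfolding exp_of_nat_mult[symmetric] by (simp flip: exp_of_real)
    finally show ?thesis by (simp only: mult.commute)
  qed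
  have f_eq: "f n = ?\<tau> / of_nat p * (\<Sum>h\<in>{1..<p}. cnj (chi h) *
      (of_nat (Suc n) ^ k * exp (2 * of_real pi * \<i> * u h) ^ Suc n))" for n
  proof -
    have "chi (Suc n) = ?\<tau> / of_nat p * (\<Sum>h<p. (cnj \<circ> chi) h * root_of_unity_exp p ((p - h) * Suc n))"
      using primitive_char_fourier[OF prim, of "Suc n"] by simp
    also have "(\<Sum>h<p. (cnj \<circ> chi) h * root_of_unity_exp p ((p - h) * Suc n)) =
      (\<Sum>h\<in>{1..<p}. (cnj \<circ> chi) h * root_of_unity_exp p ((p - h) * Suc n))"
      by (rule sum_residues_from_1[OF dirichlet_char_cnj[OF chi] p])
    finally show ?thesis
      unfolding f_def expu by (simp add: sum_distrib_left sum_distrib_right mult_ac)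
  qed
  have sm: "summable (\<lambda>n. of_nat (Suc n) ^ k * exp (2 * of_real pi * \<i> * u h) ^ Suc n)" for h
    by (rule summable_power_coeff) (use Imu[of h] in simp)
  have fsums: "f sums (?\<tau> / of_nat p * (\<Sum>h\<in>{1..<p}. cnj (chi h) *
      (\<Sum>n. of_nat (Suc n) ^ k * exp (2 * of_real pi * \<i> * u h) ^ Suc n)))"
    unfolding f_eq by (intro sums_mult sums_sum summable_sums sm)
  thus "summable f" by (rule sums_summable)
  have chi0: "(\<Sum>h\<in>{1..<p}. cnj (chi h)) = 0"
  proof -
    have "(\<Sum>h<p. chi h * 1) = (\<Sum>h\<in>{1..<p}. chi h * 1)"
      by (rule sum_residues_from_1[OF chi p])
    hence "(\<Sum>h\<in>{1..<p}. chi h) = 0"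
      using dirichlet_char_sum_eq_0[OF chi np] by simp
    thus ?thesis by (metis cnj_sum complex_cnj_zero)
  qed
  define P where "P = (\<lambda>z. \<Sum>h\<in>{1..<p}. cnj (chi h) * Polygamma k (of_nat h / of_nat p + z))"
  define c where "c = \<i> / (2 * of_real pi) / (2 * of_real pi * \<i>) ^ k"
  have P1: "(\<Sum>h\<in>{1..<p}. cnj (chi h) * Polygamma k (1 - u h)) = P (-v)"
    unfolding P_def
    by (intro sum.cong refl arg_cong2[where f = "(*)"] arg_cong[where f = "Polygamma k"])
       (use p in \<open>auto simp: u_def field_simps of_nat_diff\<close>)
  have P2: "(\<Sum>h\<in>{1..<p}. cnj (chi h) * Polygamma k (u h)) = ?\<epsilon> * P v"
  proof -
    have "(\<Sum>h\<in>{1..<p}. cnj (chi h) * Polygamma k (u h)) =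
        (\<Sum>h\<in>{1..<p}. cnj (chi (p - h)) * Polygamma k (u (p - h)))"
      by (rule sum.reindex_bij_witness[of _ "\<lambda>h. p - h" "\<lambda>h. p - h"]) auto
    also have "\<dots> = (\<Sum>h\<in>{1..<p}. ?\<epsilon> * (cnj (chi h) * Polygamma k (of_nat h / of_nat p + v)))"
    proof (intro sum.cong refl)
      fix h assume h: "h \<in> {1..<p}"
      have r: "chi (p - h) = chi (p - 1) * chi h"
        by (rule dirichlet_char_reflect[OF chi]) (use h in simp)
      show "cnj (chi (p - h)) * Polygamma k (u (p - h)) =
          ?\<epsilon> * (cnj (chi h) * Polygamma k (of_nat h / of_nat p + v))"
        unfolding r using h by (simp add: u_def add.commute)
    qed
    finally show ?thesis by (simp add: P_def sum_distrib_left)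
  qed
  have "(\<Sum>h\<in>{1..<p}. cnj (chi h) * (\<Sum>n. of_nat (Suc n) ^ k * exp (2 * of_real pi * \<i> * u h) ^ Suc n)) =
    (\<Sum>h\<in>{1..<p}. cnj (chi h) * (if k = 0 then - 1 / 2 else 0)
       + c * ((-1) ^ k * (cnj (chi h) * Polygamma k (1 - u h)) - cnj (chi h) * Polygamma k (u h)))"
    by (intro sum.cong refl, subst suminf_power_exp_Polygamma[OF Imu])
       (simp only: c_def algebra_simps)
  also have "\<dots> = c * ((-1) ^ k * P (-v) - ?\<epsilon> * P v)"
    unfolding sum.distrib sum_distrib_right[symmetric] chi0 sum_distrib_left[symmetric] sum_subtractf P1 P2
    by simp
  finally have A: "(\<Sum>n. f n) = ?\<tau> / of_nat p * (c * ((-1) ^ k * P (-v) - ?\<epsilon> * P v))"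
    using fsums by (simp add: sums_iff)
  have Psums: "(\<lambda>j. \<Sum>h\<in>{1..<p}. cnj (chi h) / (of_nat h / of_nat p + z + of_nat j) ^ Suc k) sums
      ((-1) ^ Suc k * P z / fact k)" if "Im z \<noteq> 0" for z
    unfolding P_def using that
    by (intro sum_Polygamma_sums chi0) (auto simp: complex_eq_iff Im_divide_of_nat)
  have "(\<lambda>j. (2 * of_real pi * \<i>) powi (- int (Suc k)) * (\<Sum>h\<in>{1..<p}. cnj (chi h) / (of_nat h / of_nat p + (-v) + of_nat j) ^ Suc k)
     + ?\<epsilon> * (- 2 * of_real pi * \<i>) powi (- int (Suc k)) * (\<Sum>h\<in>{1..<p}. cnj (chi h) / (of_nat h / of_nat p + v + of_nat j) ^ Suc k))
    sums ((2 * of_real pi * \<i>) powi (- int (Suc k)) * ((-1) ^ Suc k * P (-v) / fact k)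
     + ?\<epsilon> * (- 2 * of_real pi * \<i>) powi (- int (Suc k)) * ((-1) ^ Suc k * P v / fact k))"
    using w by (intro sums_add sums_mult Psums) (auto simp: Imv)
  also have "(\<lambda>j. (2 * of_real pi * \<i>) powi (- int (Suc k)) * (\<Sum>h\<in>{1..<p}. cnj (chi h) / (of_nat h / of_nat p + (-v) + of_nat j) ^ Suc k)
     + ?\<epsilon> * (- 2 * of_real pi * \<i>) powi (- int (Suc k)) * (\<Sum>h\<in>{1..<p}. cnj (chi h) / (of_nat h / of_nat p + v + of_nat j) ^ Suc k))
   = (\<lambda>j. \<Sum>h\<in>{1..<p}. cnj (chi h) * lipschitz_kernel k ?\<epsilon> w (2 * pi * real (j * p + h) / real p))"
  proof
    fix j
    have 1: "Complex w (2 * pi * real (j * p + h) / real p) =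
        2 * of_real pi * \<i> * (of_nat h / of_nat p + (-v) + of_nat j)" for h
      using p by (simp add: Complex_eq v_def field_simps)
    have 2: "Complex w (- (2 * pi * real (j * p + h) / real p)) =
        - 2 * of_real pi * \<i> * (of_nat h / of_nat p + v + of_nat j)" for h
      using p by (simp add: Complex_eq v_def field_simps)
    show "(2 * of_real pi * \<i>) powi (- int (Suc k)) * (\<Sum>h\<in>{1..<p}. cnj (chi h) / (of_nat h / of_nat p + (-v) + of_nat j) ^ Suc k)
     + ?\<epsilon> * (- 2 * of_real pi * \<i>) powi (- int (Suc k)) * (\<Sum>h\<in>{1..<p}. cnj (chi h) / (of_nat h / of_nat p + v + of_nat j) ^ Suc k)
     = (\<Sum>h\<in>{1..<p}. cnj (chi h) * lipschitz_kernel k ?\<epsilon> w (2 * pi * real (j * p + h) / real p))"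
      unfolding lipschitz_kernel_def 1 2 power_mult_distrib[of _ _ "Suc k"] sum_distrib_left sum.distrib[symmetric] power_int_minus power_int_of_nat
      by (intro sum.cong refl) (simp add: distrib_left divide_inverse mult_ac del: power_Suc)
  qed
  finally have S: "(\<lambda>j. \<Sum>h\<in>{1..<p}. cnj (chi h) * lipschitz_kernel k ?\<epsilon> w (2 * pi * real (j * p + h) / real p))
    sums ((2 * of_real pi * \<i>) powi (- int (Suc k)) * ((-1) ^ Suc k * P (-v) / fact k)
     + ?\<epsilon> * (- 2 * of_real pi * \<i>) powi (- int (Suc k)) * ((-1) ^ Suc k * P v / fact k))" .
  have "fact k * ?\<tau> / of_nat p * ((2 * of_real pi * \<i>) powi (- int (Suc k)) * ((-1) ^ Suc k * P (-v) / fact k)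
     + ?\<epsilon> * (- 2 * of_real pi * \<i>) powi (- int (Suc k)) * ((-1) ^ Suc k * P v / fact k)) = (\<Sum>n. f n)"
  proof -
    define d where "d = 2 * of_real pi * \<i>"
    have d: "d \<noteq> 0" by (simp add: d_def)
    have m: "(-2 * of_real pi * \<i>) ^ Suc k = (-1) ^ Suc k * d ^ Suc k"
      unfolding d_def power_mult_distrib[symmetric] by simp
    have c: "c = - 1 / d ^ Suc k"
      by (simp add: c_def d_def field_simps)
    have s: "(-1) ^ Suc k * (-1) ^ Suc k = (1::complex)" by (simp flip: power_mult_distrib)
    have "inverse ((-1) ^ Suc k :: complex) = (-1) ^ Suc k"
      by (simp add: power_inverse[symmetric])
    hence "inverse (d ^ Suc k) * ((-1) ^ Suc k * P (-v) / fact k) +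
       ?\<epsilon> * inverse ((-1) ^ Suc k * d ^ Suc k) * ((-1) ^ Suc k * P v / fact k)
      = inverse (d ^ Suc k) * ((-1) ^ Suc k * P (-v) + ?\<epsilon> * ((-1) ^ Suc k * (-1) ^ Suc k) * P v) / fact k"
      unfolding inverse_mult_distrib by (simp only: algebra_simps add_divide_distrib times_divide_eq_right times_divide_eq_left)
    also have "\<dots> = c * ((-1) ^ k * P (-v) - ?\<epsilon> * P v) / fact k"
      unfolding s c by (simp add: divide_inverse algebra_simps)
    finally show ?thesis
      unfolding A power_int_minus power_int_of_nat m d_def[symmetric] by simp
  qed
  thus "(\<lambda>j. fact k * gauss_sum p chi / of_nat p * (\<Sum>h\<in>{1..<p}. cnj (chi h) *
            lipschitz_kernel k (cnj (chi (p - 1))) w (2 * pi * real (j * p + h) / real p))) sums (\<Sum>n. f n)"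
    using sums_mult[OF S, of "fact k * ?\<tau> / of_nat p"] by simp
qed

section \<open>Double series\<close>

lemma abs_summable_on_product_bound:
  fixes B :: "nat \<Rightarrow> nat \<Rightarrow> 'a :: real_normed_vector" and u v :: "nat \<Rightarrow> real"
  assumes B: "\<And>i j. norm (B i j) \<le> u i * v j"
    and u: "summable u" "\<And>i. u i \<ge> 0" and v: "summable v" "\<And>j. v j \<ge> 0"
  shows "(\<lambda>x. norm (case x of (i,j) \<Rightarrow> B i j)) summable_on UNIV \<times> UNIV"
proof -
  have uv: "(\<lambda>x. norm (case x of (i,j) \<Rightarrow> u i * v j)) summable_on UNIV \<times> UNIV"
  proof (rule Infinite_Sum.abs_summable_on_Sigma_iff[THEN iffD2], intro conjI ballI)
    fix i :: nat
    show "(\<lambda>j. norm (case (i, j) of (i, j) \<Rightarrow> u i * v j)) summable_on UNIV"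
      using norm_summable_imp_summable_on[of "\<lambda>j. norm (u i * v j)"] u v
      by (simp add: summable_mult)
  next
    have "infsum (\<lambda>j. norm (u i * v j)) UNIV = u i * infsum v UNIV" for i
      using u v by (simp add: infsum_cmult_right')
    moreover have "infsum v UNIV \<ge> 0" by (simp add: infsum_nonneg v)
    ultimately show "(\<lambda>i. norm (\<Sum>\<^sub>\<infinity>j. norm (case (i, j) of (i, j) \<Rightarrow> u i * v j))) summable_on UNIV"
      using norm_summable_imp_summable_on[of "\<lambda>i. norm (u i * infsum v UNIV)"] u v
      by (simp add: summable_mult2)
  qed
  show ?thesis
    by (rule Infinite_Sum.abs_summable_on_comparison_test[OF uv])
       (use B u v in \<open>auto simp: abs_mult\<close>)
qed

lemma iterated_sums_swap:
  fixes B :: "nat \<Rightarrow> nat \<Rightarrow> 'a :: banach" and u v :: "nat \<Rightarrow> real"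
  assumes "\<And>i j. norm (B i j) \<le> u i * v j"
    and "summable u" "\<And>i. u i \<ge> 0" and "summable v" "\<And>j. v j \<ge> 0"
  shows "summable (\<lambda>j. B i j)" "summable (\<lambda>i. B i j)"
    and "(\<lambda>i. \<Sum>j. B i j) sums infsum (\<lambda>(i,j). B i j) (UNIV \<times> UNIV)"
    and "(\<lambda>j. \<Sum>i. B i j) sums infsum (\<lambda>(i,j). B i j) (UNIV \<times> UNIV)"
proof -
  have Bs: "(\<lambda>x. norm (case x of (i,j) \<Rightarrow> B i j)) summable_on UNIV \<times> UNIV"
    by (rule abs_summable_on_product_bound[of B u v]) (use assms in auto)
  hence Bs': "(\<lambda>x. norm (case x of (j,i) \<Rightarrow> B i j)) summable_on UNIV \<times> UNIV"
    by (subst (asm) summable_on_reindex_bij_witness[of "UNIV \<times> UNIV" prod.swap prod.swap "UNIV \<times> UNIV"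
           "\<lambda>x. norm ((\<lambda>(j,i). B i j) x)"]) auto
  have row: "(\<lambda>j. norm (B i j)) summable_on UNIV" for i
    using Infinite_Sum.abs_summable_on_Sigma_iff[THEN iffD1, OF Bs] by auto
  have col: "(\<lambda>i. norm (B i j)) summable_on UNIV" for j
    using Infinite_Sum.abs_summable_on_Sigma_iff[THEN iffD1, OF Bs'] by auto
  show "summable (\<lambda>j. B i j)" "summable (\<lambda>i. B i j)"
    using abs_summable_summable[OF row] abs_summable_summable[OF col]
    by (auto intro: summable_on_imp_summable)
  have inf_row: "infsum (B i) UNIV = (\<Sum>j. B i j)" for i
    by (rule sums_unique) (rule has_sum_imp_sums[OF has_sum_infsum[OF abs_summable_summable[OF row]]])
  have inf_col: "infsum (\<lambda>i. B i j) UNIV = (\<Sum>i. B i j)" for j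
    by (rule sums_unique) (rule has_sum_imp_sums[OF has_sum_infsum[OF abs_summable_summable[OF col]]])
  have "((\<lambda>i. infsum (B i) UNIV) has_sum infsum (\<lambda>(i,j). B i j) (UNIV \<times> UNIV)) UNIV"
    using has_sum_SigmaD[OF has_sum_infsum[OF abs_summable_summable[OF Bs]]]
      has_sum_infsum[OF abs_summable_summable[OF row]]
    by auto
  moreover have "((\<lambda>j. infsum (\<lambda>i. B i j) UNIV) has_sum infsum (\<lambda>(j,i). B i j) (UNIV \<times> UNIV)) UNIV"
    using has_sum_SigmaD[OF has_sum_infsum[OF abs_summable_summable[OF Bs']]]
      has_sum_infsum[OF abs_summable_summable[OF col]]
    by auto
  moreover have "infsum (\<lambda>(j,i). B i j) (UNIV \<times> UNIV) = infsum (\<lambda>(i,j). B i j) (UNIV \<times> UNIV)"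
    by (rule infsum_reindex_bij_witness[of _ prod.swap prod.swap]) auto
  ultimately show "(\<lambda>i. \<Sum>j. B i j) sums infsum (\<lambda>(i,j). B i j) (UNIV \<times> UNIV)"
    "(\<lambda>j. \<Sum>i. B i j) sums infsum (\<lambda>(i,j). B i j) (UNIV \<times> UNIV)"
    unfolding inf_row inf_col by (auto dest!: has_sum_imp_sums)
qed

lemma has_field_derivative_inverse_power:
  fixes z :: complex
  assumes "z \<noteq> 0"
  shows "((\<lambda>z. 1 / z ^ Suc n) has_field_derivative - of_nat (Suc n) / z ^ Suc (Suc n)) (at z within S)"
proof -
  have "((\<lambda>z. 1 / z ^ Suc n) has_field_derivative
      (0 * z ^ Suc n - 1 * (of_nat (Suc n) * z ^ n)) / (z ^ Suc n * z ^ Suc n)) (at z within S)"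
    using assms
    by (intro DERIV_divide DERIV_const)
       (auto intro!: derivative_eq_intros simp del: power_Suc)
  also have "(0 * z ^ Suc n - 1 * (of_nat (Suc n) * z ^ n)) / (z ^ Suc n * z ^ Suc n) =
      - of_nat (Suc n) / z ^ Suc (Suc n)"
    using assms by (simp add: divide_simps)
  finally show ?thesis .
qed

lemma mixed_difference_inverse_power:
  fixes a a' b b' :: real
  assumes "0 < a" "a \<le> a'" "0 < b" "b \<le> b'"
  shows "norm (1 / Complex a' b' ^ Suc k - 1 / Complex a b' ^ Suc k - (1 / Complex a' b ^ Suc k - 1 / Complex a b ^ Suc k))
    \<le> (real k + 1) * (real k + 2) / ((a + b) / 2) ^ (k + 3) * (a' - a) * (b' - b)"
proof -
  define S where "S = {z::complex. a \<le> Re z} \<inter> {z. b \<le> Im z}"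
  define M where "M = (real k + 1) * (real k + 2) / ((a + b) / 2) ^ (k + 3)"
  have "convex S" unfolding S_def by (intro convex_Int convex_halfspace_Re_ge convex_halfspace_Im_ge)
  have nz: "z \<noteq> 0" if "z \<in> S" for z using that assms by (auto simp: S_def)
  have shift: "z + of_real t \<in> S" if "z \<in> S" "t \<ge> 0" for z t using that by (auto simp: S_def)
  have normS: "norm z \<ge> (a + b) / 2" if "z \<in> S" for z
    using that abs_Re_le_cmod[of z] abs_Im_le_cmod[of z] unfolding S_def by auto
  define f' :: "complex \<Rightarrow> complex" where "f' = (\<lambda>z. - of_nat (Suc k) / z ^ Suc (Suc k))"
  have dfU: "((\<lambda>z. 1 / z ^ Suc k) has_field_derivative f' z) (at z)" if "z \<noteq> 0" for z
    unfolding f'_def by (rule has_field_derivative_inverse_power[OF that])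
  have df': "(f' has_field_derivative (of_nat k + 1) * (of_nat k + 2) / z ^ (k + 3)) (at z within S)" if "z \<noteq> 0" for z
  proof -
    have "((\<lambda>z. - of_nat (Suc k) * (1 / z ^ Suc (Suc k))) has_field_derivative
        - of_nat (Suc k) * (- of_nat (Suc (Suc k)) / z ^ Suc (Suc (Suc k)))) (at z within S)"
      by (intro DERIV_cmult has_field_derivative_inverse_power that)
    also have "- of_nat (Suc k) * (- of_nat (Suc (Suc k)) / z ^ Suc (Suc (Suc k))) =
        (of_nat k + 1) * (of_nat k + 2) / z ^ (k + 3)"
      by (simp add: algebra_simps eval_nat_numeral)
    finally show ?thesis by (simp add: f'_def)
  qed
  have M: "norm ((of_nat k + 1) * (of_nat k + 2) / z ^ (k + 3)) \<le> M" if "z \<in> S" for z :: complex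
  proof -
    have "norm ((of_nat k + 1) * (of_nat k + 2) / z ^ (k + 3)) = (real k + 1) * (real k + 2) / norm z ^ (k + 3)"
    proof -
      have "norm (of_nat k + 1 :: complex) = real k + 1" "norm (of_nat k + 2 :: complex) = real k + 2"
        using norm_of_nat[of "k + 1", where 'a = complex] norm_of_nat[of "k + 2", where 'a = complex]
        unfolding of_nat_add by simp_all
      thus ?thesis by (simp add: norm_divide norm_mult norm_power)
    qed
    also have "\<dots> \<le> M"
      unfolding M_def using normS[OF that] nz[OF that] assms
      by (intro divide_left_mono power_mono mult_pos_pos) auto
    finally show ?thesis .
  qed
  define g :: "complex \<Rightarrow> complex" where "g = (\<lambda>z. 1 / (z + of_real (a' - a)) ^ Suc k - 1 / z ^ Suc k)"
  have "norm (g (Complex a b') - g (Complex a b)) \<le> M * (a' - a) * norm (Complex a b' - Complex a b)"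
  proof (rule field_differentiable_bound[OF \<open>convex S\<close>])
    fix z assume z: "z \<in> S"
    have z': "z + of_real (a' - a) \<in> S" using shift[OF z, of "a' - a"] assms by simp
    have "((\<lambda>z. 1 / z ^ Suc k) has_field_derivative f' (z + of_real (a' - a))) (at (z + of_real (a' - a)))"
      by (rule dfU) (rule nz[OF z'])
    hence "((\<lambda>z. 1 / (z + of_real (a' - a)) ^ Suc k) has_field_derivative f' (z + of_real (a' - a))) (at z)"
      by (subst (asm) DERIV_shift)
    thus "(g has_field_derivative f' (z + of_real (a' - a)) - f' z) (at z within S)"
      unfolding g_def by (intro DERIV_diff dfU[OF nz[OF z], THEN DERIV_subset]) (auto intro: DERIV_subset)
    have "norm (f' (z + of_real (a' - a)) - f' z) \<le> M * norm (z + of_real (a' - a) - z)"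
      by (rule field_differentiable_bound[OF \<open>convex S\<close> _ _ z' z]) (use df' nz M in auto)
    thus "norm (f' (z + of_real (a' - a)) - f' z) \<le> M * (a' - a)"
      using assms by (simp del: of_real_diff)
  qed (use assms in \<open>auto simp: S_def\<close>)
  moreover have "Complex a c + of_real (a' - a) = Complex a' c" for c by (simp add: complex_eq_iff)
  moreover have "norm (Complex a b' - Complex a b) = b' - b"
  proof -
    have "Complex a b' - Complex a b = \<i> * of_real (b' - b)" by (simp add: complex_eq_iff)
    thus ?thesis using assms by (simp add: norm_mult del: of_real_diff)
  qed
  ultimately show ?thesis unfolding g_def M_def by simp
qed

lemma divisor_sum_sums:
  fixes h :: "nat \<Rightarrow> nat \<Rightarrow> 'a :: banach" and u v :: "nat \<Rightarrow> real"
  assumes "\<And>i j. norm (h (Suc i) (Suc j)) \<le> u i * v j"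
    and "summable u" "\<And>i. u i \<ge> 0" and "summable v" "\<And>j. v j \<ge> 0"
  shows "summable (\<lambda>n. \<Sum>d | d dvd Suc n. norm (h d (Suc n div d)))"
    and "(\<lambda>j. \<Sum>i. h (Suc i) (Suc j)) sums (\<Sum>n. \<Sum>d | d dvd Suc n. h d (Suc n div d))"
proof -
  define D where "D = Sigma (UNIV :: nat set) (\<lambda>n. {d. d dvd Suc n})"
  have Bs: "(\<lambda>x. norm (case x of (i,j) \<Rightarrow> h (Suc i) (Suc j))) summable_on UNIV \<times> UNIV"
    by (rule abs_summable_on_product_bound[of "\<lambda>i j. h (Suc i) (Suc j)" u v]) (use assms in auto)
  have reindex: "((\<lambda>(n,d). g d (Suc n div d)) has_sum S) D \<longleftrightarrow>
      ((\<lambda>(i,j). g (Suc i) (Suc j)) has_sum S) (UNIV \<times> UNIV)"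
    for g :: "nat \<Rightarrow> nat \<Rightarrow> 'b :: banach" and S
  proof (rule has_sum_reindex_bij_witness[of _ "\<lambda>(i,j). (Suc i * Suc j - 1, Suc i)"
        "\<lambda>(n,d). (d - 1, Suc n div d - 1)"])
    have pos: "d > 0 \<and> Suc n div d > 0" if "d dvd Suc n" for n d
      using that by (metis dvd_div_eq_0_iff dvd_pos_nat nat.distinct(1) neq0_conv)
    fix x assume "x \<in> D"
    then obtain n d where x: "x = (n, d)" "d dvd Suc n" by (auto simp: D_def)
    from pos[OF x(2)] have *: "Suc (d - 1) = d" "Suc (Suc n div d - 1) = Suc n div d" by auto
    show "(case case x of (n, d) \<Rightarrow> (d - 1, Suc n div d - 1) of (i, j) \<Rightarrow> (Suc i * Suc j - 1, Suc i)) = x"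
      using x(2) unfolding x(1) prod.case * by simp
    show "(case case x of (n, d) \<Rightarrow> (d - 1, Suc n div d - 1) of (i, j) \<Rightarrow> g (Suc i) (Suc j)) =
         (case x of (n, d) \<Rightarrow> g d (Suc n div d))"
      unfolding x(1) prod.case * ..
  qed (auto simp: D_def simp del: mult_Suc mult_Suc_right)
  have collect: "((\<lambda>n. \<Sum>d | d dvd Suc n. g d (Suc n div d)) has_sum S) UNIV"
    if "((\<lambda>(n,d). g d (Suc n div d)) has_sum S) D" for g :: "nat \<Rightarrow> nat \<Rightarrow> 'b :: banach" and S
    using that unfolding D_def by (rule has_sum_SigmaD) (auto intro!: has_sum_finiteI)
  have "((\<lambda>(i,j). norm (h (Suc i) (Suc j))) has_sum infsum (\<lambda>x. norm (case x of (i,j) \<Rightarrow> h (Suc i) (Suc j))) (UNIV \<times> UNIV)) (UNIV \<times> UNIV)"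
    using has_sum_infsum[OF Bs] by (simp add: case_prod_unfold)
  from collect[OF reindex[THEN iffD2, OF this]]
  show "summable (\<lambda>n. \<Sum>d | d dvd Suc n. norm (h d (Suc n div d)))"
    by (intro summable_on_imp_summable) (auto simp: summable_on_def)
  have "(\<lambda>n. \<Sum>d | d dvd Suc n. h d (Suc n div d)) sums infsum (\<lambda>(i,j). h (Suc i) (Suc j)) (UNIV \<times> UNIV)"
    by (rule has_sum_imp_sums[OF collect[OF reindex[THEN iffD2, OF has_sum_infsum[OF abs_summable_summable[OF Bs]]]]])
  moreover have "(\<lambda>j. \<Sum>i. h (Suc i) (Suc j)) sums infsum (\<lambda>(i,j). h (Suc i) (Suc j)) (UNIV \<times> UNIV)"
    by (rule iterated_sums_swap[where B = "\<lambda>i j. h (Suc i) (Suc j)" and u = u and v = v]) (use assms in auto)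
  ultimately show "(\<lambda>j. \<Sum>i. h (Suc i) (Suc j)) sums (\<Sum>n. \<Sum>d | d dvd Suc n. h d (Suc n div d))"
    by (simp add: sums_iff)
qed

lemma lipschitz_kernel_mixed_difference:
  assumes "0 < a" "a \<le> a'" "0 < b" "b \<le> b'" "norm \<epsilon> \<le> 1"
  shows "norm (lipschitz_kernel k \<epsilon> a' b' - lipschitz_kernel k \<epsilon> a b' - (lipschitz_kernel k \<epsilon> a' b - lipschitz_kernel k \<epsilon> a b))
    \<le> 2 * ((real k + 1) * (real k + 2) / ((a + b) / 2) ^ (k + 3) * (a' - a) * (b' - b))"
proof -
  define D where "D = 1 / Complex a' b' ^ Suc k - 1 / Complex a b' ^ Suc k - (1 / Complex a' b ^ Suc k - 1 / Complex a b ^ Suc k)"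
  have "Complex x (- y) = cnj (Complex x y)" for x y by (simp add: complex_eq_iff)
  hence "lipschitz_kernel k \<epsilon> a' b' - lipschitz_kernel k \<epsilon> a b' - (lipschitz_kernel k \<epsilon> a' b - lipschitz_kernel k \<epsilon> a b)
      = D + \<epsilon> * cnj D"
    by (simp add: lipschitz_kernel_def D_def algebra_simps del: power_Suc)
  also have "norm \<dots> \<le> norm D + norm \<epsilon> * norm D"
    by (metis complex_mod_cnj norm_mult norm_triangle_ineq)
  also have "\<dots> \<le> 2 * norm D"
    using mult_right_mono[OF assms(5) norm_ge_zero[of D]] by simp
  also have "norm D \<le> (real k + 1) * (real k + 2) / ((a + b) / 2) ^ (k + 3) * (a' - a) * (b' - b)"
    unfolding D_def by (rule mixed_difference_inverse_power) (use assms in auto)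
  finally show ?thesis by simp
qed

lemma summable_inverse_sqrt_cubed: "summable (\<lambda>n. 1 / sqrt (real (Suc n)) ^ 3)"
proof -
  have "summable (\<lambda>n. real (Suc n) powr (- 3 / 2))"
    by (subst summable_Suc_iff) (simp add: summable_real_powr_iff)
  also have "(\<lambda>n. real (Suc n) powr (- 3 / 2)) = (\<lambda>n. 1 / sqrt (real (Suc n)) ^ 3)"
  proof
    fix n
    have "sqrt (real (Suc n)) ^ 3 = real (Suc n) powr (3 / 2)"
      by (simp add: powr_half_sqrt[symmetric] powr_powr flip: powr_realpow)
    thus "real (Suc n) powr (- 3 / 2) = 1 / sqrt (real (Suc n)) ^ 3"
      by (simp add: powr_minus_divide)
  qed
  finally show ?thesis .
qed

lemma kernel_block_bound:
  fixes c d :: "nat \<Rightarrow> complex" and y \<alpha> :: real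
  assumes c: "(\<Sum>r\<in>{1..<q}. c r) = 0" "\<And>r. norm (c r) \<le> 1"
    and d: "(\<Sum>s\<in>{1..<p}. d s) = 0" "\<And>s. norm (d s) \<le> 1"
    and \<epsilon>: "norm \<epsilon> \<le> 1" and pos: "y > 0" "\<alpha> > 0" "q > 0" "p > 0"
  obtains C where "C \<ge> 0"
    "\<And>i j. norm (\<Sum>r\<in>{1..<q}. \<Sum>s\<in>{1..<p}. c r * (d s * lipschitz_kernel k \<epsilon> (real (i * q + r) * y) (\<alpha> * real (j * p + s))))
       \<le> C * (1 / sqrt (real (Suc i)) ^ 3) * (1 / sqrt (real (Suc j)) ^ 3)"
proof
  define M where "M = 2 * ((real k + 1) * (real k + 2) * (real q * y) * (real p * \<alpha>)) / sqrt (y * \<alpha>) ^ (k + 3)"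
  have M: "M \<ge> 0" unfolding M_def using pos by simp
  show "real q * real p * M \<ge> 0" using M by simp
  fix i j
  define K where "K = (\<lambda>r s. lipschitz_kernel k \<epsilon> (real (i * q + r) * y) (\<alpha> * real (j * p + s)))"
  have bound: "norm (K r s - K 1 s - (K r 1 - K 1 1)) \<le> M * (1 / sqrt (real (Suc i)) ^ 3) * (1 / sqrt (real (Suc j)) ^ 3)"
    if r: "r \<in> {1..<q}" and s: "s \<in> {1..<p}" for r s
  proof -
    define a where "a = real (i * q + 1) * y"
    define b where "b = \<alpha> * real (j * p + 1)"
    have "real (i * q + 1) > 0" "real (j * p + 1) > 0" unfolding of_nat_0_less_iff by simp_all
    hence ab: "a > 0" "b > 0" unfolding a_def b_def using pos by (simp_all only: mult_pos_pos)
    have aa: "a \<le> real (i * q + r) * y" unfolding a_def using r pos by (intro mult_right_mono) auto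
    have bb: "b \<le> \<alpha> * real (j * p + s)" unfolding b_def using s pos by (intro mult_left_mono) auto
    define X where "X = sqrt (real (Suc i)) * sqrt (real (Suc j))"
    have X: "X \<ge> 1" unfolding X_def
      using mult_mono[of 1 "sqrt (real (Suc i))" 1 "sqrt (real (Suc j))"] by simp
    have "sqrt (y * \<alpha>) * X \<le> (a + b) / 2"
    proof -
      have *: "real (Suc i) \<le> real (i * q + 1)" "real (Suc j) \<le> real (j * p + 1)"
        unfolding of_nat_le_iff using pos by simp_all
      have "y * real (Suc i) \<le> a" unfolding a_def mult.commute[of y]
        using pos * by (intro mult_right_mono) auto
      moreover have "\<alpha> * real (Suc j) \<le> b" unfolding b_def
        using pos * by (intro mult_left_mono) auto
      ultimately have "(y * real (Suc i)) * (\<alpha> * real (Suc j)) \<le> a * b"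
        using pos ab by (intro mult_mono) auto
      hence "sqrt ((y * real (Suc i)) * (\<alpha> * real (Suc j))) \<le> sqrt (a * b)" by simp
      also have "\<dots> \<le> (a + b) / 2" using ab arith_geo_mean_sqrt[of a b] by simp
      finally show ?thesis unfolding X_def by (simp add: real_sqrt_mult mult_ac)
    qed
    hence "(sqrt (y * \<alpha>) * X) ^ (k + 3) \<le> ((a + b) / 2) ^ (k + 3)"
      using pos X by (intro power_mono) auto
    moreover have "sqrt (y * \<alpha>) ^ (k + 3) * X ^ 3 \<le> (sqrt (y * \<alpha>) * X) ^ (k + 3)"
      unfolding power_mult_distrib using pos X by (intro mult_left_mono power_increasing) auto
    ultimately have den: "sqrt (y * \<alpha>) ^ (k + 3) * X ^ 3 \<le> ((a + b) / 2) ^ (k + 3)" by linarith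
    have "norm (K r s - K 1 s - (K r 1 - K 1 1)) \<le> 2 * ((real k + 1) * (real k + 2) / ((a + b) / 2) ^ (k + 3) *
        (real (i * q + r) * y - a) * (\<alpha> * real (j * p + s) - b))"
      unfolding K_def a_def b_def
      by (rule lipschitz_kernel_mixed_difference) (use aa bb ab \<epsilon> in \<open>auto simp: a_def b_def\<close>)
    also have "\<dots> \<le> 2 * ((real k + 1) * (real k + 2) / (sqrt (y * \<alpha>) ^ (k + 3) * X ^ 3) *
        (real q * y) * (real p * \<alpha>))"
    proof (intro mult_left_mono mult_mono divide_left_mono den)
      have "(real (i * q + r) * y - a) = (real r - 1) * y" by (simp add: a_def algebra_simps)
      thus "real (i * q + r) * y - a \<le> real q * y" using r pos by simp
      have "(\<alpha> * real (j * p + s) - b) = (real s - 1) * \<alpha>" by (simp add: b_def algebra_simps)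
      thus "\<alpha> * real (j * p + s) - b \<le> real p * \<alpha>" using s pos by simp
    qed (use aa bb ab pos X in auto)
    also have "\<dots> = M * (1 / sqrt (real (Suc i)) ^ 3) * (1 / sqrt (real (Suc j)) ^ 3)"
      by (simp add: M_def X_def power_mult_distrib field_simps)
    finally show ?thesis .
  qed
  have "(\<Sum>r\<in>{1..<q}. \<Sum>s\<in>{1..<p}. c r * (d s * K r s)) =
      (\<Sum>r\<in>{1..<q}. \<Sum>s\<in>{1..<p}. c r * (d s * (K r s - K 1 s - (K r 1 - K 1 1))))"
  proof -
    have "(\<Sum>r\<in>{1..<q}. \<Sum>s\<in>{1..<p}. c r * (d s * (K r s - K 1 s - (K r 1 - K 1 1)))) =
       (\<Sum>r\<in>{1..<q}. \<Sum>s\<in>{1..<p}. c r * (d s * K r s)) - (\<Sum>r\<in>{1..<q}. c r) * (\<Sum>s\<in>{1..<p}. d s * K 1 s)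
       - (\<Sum>r\<in>{1..<q}. c r * (K r 1 - K 1 1)) * (\<Sum>s\<in>{1..<p}. d s)"
      unfolding sum_product sum_subtractf[symmetric]
      by (intro sum.cong refl) (simp add: algebra_simps)
    thus ?thesis unfolding c d by simp
  qed
  also have "norm \<dots> \<le> (\<Sum>r\<in>{1..<q}. \<Sum>s\<in>{1..<p}. M * (1 / sqrt (real (Suc i)) ^ 3) * (1 / sqrt (real (Suc j)) ^ 3))"
  proof (intro sum_norm_le)
    fix r s assume rs: "r \<in> {1..<q}" "s \<in> {1..<p}"
    have "norm (c r * (d s * (K r s - K 1 s - (K r 1 - K 1 1)))) \<le> 1 * (1 * norm (K r s - K 1 s - (K r 1 - K 1 1)))"
      unfolding norm_mult by (intro mult_mono c d) auto
    with bound[OF rs] show "norm (c r * (d s * (K r s - K 1 s - (K r 1 - K 1 1)))) \<le> M * (1 / sqrt (real (Suc i)) ^ 3) * (1 / sqrt (real (Suc j)) ^ 3)"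
      by linarith
  qed
  also have "\<dots> = real (q - 1) * real (p - 1) * M * (1 / sqrt (real (Suc i)) ^ 3) * (1 / sqrt (real (Suc j)) ^ 3)"
    by simp
  also have "\<dots> \<le> real q * real p * M * (1 / sqrt (real (Suc i)) ^ 3) * (1 / sqrt (real (Suc j)) ^ 3)"
    using M by (intro mult_right_mono mult_mono) auto
  finally show "norm (\<Sum>r\<in>{1..<q}. \<Sum>s\<in>{1..<p}. c r * (d s * lipschitz_kernel k \<epsilon> (real (i * q + r) * y) (\<alpha> * real (j * p + s))))
       \<le> real q * real p * M * (1 / sqrt (real (Suc i)) ^ 3) * (1 / sqrt (real (Suc j)) ^ 3)"
    unfolding K_def .
qed

section \<open>The Eisenstein series and its transformation\<close>

definition eisenstein :: "nat \<Rightarrow> (nat \<Rightarrow> complex) \<Rightarrow> (nat \<Rightarrow> complex) \<Rightarrow> real \<Rightarrow> complex" where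
  "eisenstein k chi1 chi2 y = (\<Sum>n. sigma_chi (of_nat k) chi1 chi2 (Suc n) * of_real (exp (- (real (Suc n) * y))))"

lemma sigma_chi_conv:
  assumes "n > 0"
  shows "sigma_chi (of_nat k) chi1 chi2 n = (\<Sum>d | d dvd n. of_nat d ^ k * chi1 d * chi2 (n div d))"
  unfolding sigma_chi_def
proof (intro sum.cong refl)
  fix d assume "d \<in> {d. d dvd n}"
  hence "d > 0" using assms by (auto intro: Nat.gr0I)
  thus "of_nat d powr of_nat k * chi1 d * chi2 (n div d) = of_nat d ^ k * chi1 d * chi2 (n div d)"
    by (simp add: powr_nat')
qed

lemma dirichlet_char_exp_bound:
  assumes "dirichlet_char p chi1" "dirichlet_char q chi2" "y > 0"
  shows "norm (of_nat (Suc i) ^ k * chi1 (Suc i) * chi2 (Suc j) * of_real (exp (- (real (Suc i * Suc j) * y))))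
    \<le> real (Suc i) ^ k * exp (- (y / 2)) ^ Suc i * exp (- (y / 2)) ^ Suc j"
proof -
  have "norm (of_nat (Suc i) ^ k * chi1 (Suc i) * chi2 (Suc j) * of_real (exp (- (real (Suc i * Suc j) * y))) :: complex)
      = real (Suc i) ^ k * norm (chi1 (Suc i)) * norm (chi2 (Suc j)) * exp (- (real (Suc i * Suc j) * y))"
    unfolding norm_mult norm_power norm_of_nat norm_of_real abs_exp_cancel ..
  also have "\<dots> \<le> real (Suc i) ^ k * 1 * 1 * exp (- (real (Suc i * Suc j) * y))"
    by (intro mult_mono dirichlet_char_norm_le[OF assms(1)] dirichlet_char_norm_le[OF assms(2)]) auto
  also have "exp (- (real (Suc i * Suc j) * y)) \<le> exp (real (Suc i) * (- (y / 2)) + real (Suc j) * (- (y / 2)))"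
  proof -
    have "(real (Suc i) + real (Suc j)) / 2 \<le> real (Suc i * Suc j)"
      by (simp add: algebra_simps)
    from mult_right_mono[OF this, of y] assms show ?thesis by (simp add: field_simps)
  qed
  also have "\<dots> = exp (- (y / 2)) ^ Suc i * exp (- (y / 2)) ^ Suc j"
    unfolding exp_add exp_of_nat_mult ..
  finally show ?thesis by (simp add: mult_ac)
qed

lemma summable_power_exp:
  fixes y :: real
  assumes "y > 0"
  shows "summable (\<lambda>i. real (Suc i) ^ k * exp (- (y / 2)) ^ Suc i)"
proof -
  have "summable (\<lambda>i. Re (of_nat (Suc i) ^ k * of_real (exp (- (y / 2))) ^ Suc i))"
    by (intro summable_Re summable_power_coeff) (use assms in simp)
  also have "(\<lambda>i. Re (of_nat (Suc i) ^ k * of_real (exp (- (y / 2))) ^ Suc i)) = (\<lambda>i. real (Suc i) ^ k * exp (- (y / 2)) ^ Suc i)"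
  proof
    fix i
    have "of_nat (Suc i) ^ k * of_real (exp (- (y / 2))) ^ Suc i =
        complex_of_real (real (Suc i) ^ k * exp (- (y / 2)) ^ Suc i)" by simp
    thus "Re (of_nat (Suc i) ^ k * of_real (exp (- (y / 2))) ^ Suc i) = real (Suc i) ^ k * exp (- (y / 2)) ^ Suc i"
      by (simp only: Re_complex_of_real)
  qed
  finally show ?thesis .
qed

lemma summable_sigma_chi_exp:
  assumes "dirichlet_char p chi1" "dirichlet_char q chi2" "y > 0"
  shows "summable (\<lambda>n. norm (sigma_chi (of_nat k) chi1 chi2 (Suc n) * of_real (exp (- (real (Suc n) * y)))))"
    and "(\<lambda>m. chi2 (Suc m) * (\<Sum>i. chi1 (Suc i) * of_nat (Suc i) ^ k * of_real (exp (- (real (Suc i) * (real (Suc m) * y))))))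
      sums eisenstein k chi1 chi2 y"
proof -
  define h where "h = (\<lambda>d m. of_nat d ^ k * chi1 d * chi2 m * complex_of_real (exp (- (real (d * m) * y))))"
  define u where "u = (\<lambda>i. real (Suc i) ^ k * exp (- (y / 2)) ^ Suc i)"
  define v where "v = (\<lambda>j. exp (- (y / 2)) ^ Suc j)"
  have u: "summable u" "u i \<ge> 0" for i
    unfolding u_def using summable_power_exp[OF assms(3)] by simp_all
  have v: "summable v" "v i \<ge> 0" for i
    unfolding v_def using summable_power_exp[OF assms(3), of 0] by simp_all
  have h: "norm (h (Suc i) (Suc j)) \<le> u i * v j" for i j
    unfolding h_def u_def v_def using dirichlet_char_exp_bound[OF assms] by simp
  have eq: "sigma_chi (of_nat k) chi1 chi2 (Suc n) * of_real (exp (- (real (Suc n) * y))) =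
      (\<Sum>d | d dvd Suc n. h d (Suc n div d))" for n
    unfolding sigma_chi_conv[OF zero_less_Suc] sum_distrib_right h_def
    by (intro sum.cong refl) (simp del: of_nat_Suc)
  show "summable (\<lambda>n. norm (sigma_chi (of_nat k) chi1 chi2 (Suc n) * of_real (exp (- (real (Suc n) * y)))))"
    unfolding eq
    by (rule summable_comparison_test'[OF divisor_sum_sums(1)[of h u v]])
       (use h u v norm_sum in auto)
  have "(\<lambda>j. \<Sum>i. h (Suc i) (Suc j)) sums (\<Sum>n. \<Sum>d | d dvd Suc n. h d (Suc n div d))"
    by (rule divisor_sum_sums(2)[of h u v]) (use h u v in auto)
  also have "(\<Sum>n. \<Sum>d | d dvd Suc n. h d (Suc n div d)) = eisenstein k chi1 chi2 y"
    unfolding eisenstein_def eq ..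
  also have "(\<lambda>j. \<Sum>i. h (Suc i) (Suc j)) = (\<lambda>m. chi2 (Suc m) * (\<Sum>i. chi1 (Suc i) * of_nat (Suc i) ^ k * of_real (exp (- (real (Suc i) * (real (Suc m) * y))))))"
  proof
    fix m
    have "summable (\<lambda>i. chi1 (Suc i) * of_nat (Suc i) ^ k * of_real (exp (- (real (Suc i) * (real (Suc m) * y)))))"
    proof (rule summable_comparison_test')
      show "summable (\<lambda>i. real (Suc i) ^ k * exp (- ((2 * (real (Suc m) * y)) / 2)) ^ Suc i)"
        by (rule summable_power_exp) (use assms in simp)
      fix i
      have "norm (chi1 (Suc i) * of_nat (Suc i) ^ k * of_real (exp (- (real (Suc i) * (real (Suc m) * y)))) :: complex)
         = norm (chi1 (Suc i)) * (real (Suc i) ^ k * exp (real (Suc i) * - (real (Suc m) * y)))"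
        unfolding norm_mult norm_power norm_of_nat norm_of_real abs_exp_cancel by simp
      also have "\<dots> \<le> 1 * (real (Suc i) ^ k * exp (real (Suc i) * - (real (Suc m) * y)))"
        by (intro mult_right_mono dirichlet_char_norm_le[OF assms(1)]) auto
      finally show "norm (chi1 (Suc i) * of_nat (Suc i) ^ k * of_real (exp (- (real (Suc i) * (real (Suc m) * y)))) :: complex)
        \<le> real (Suc i) ^ k * exp (- ((2 * (real (Suc m) * y)) / 2)) ^ Suc i"
        unfolding exp_of_nat_mult by simp
    qed
    from suminf_mult[OF this, of "chi2 (Suc m)"]
    show "(\<Sum>i. h (Suc i) (Suc m)) = chi2 (Suc m) * (\<Sum>i. chi1 (Suc i) * of_nat (Suc i) ^ k * of_real (exp (- (real (Suc i) * (real (Suc m) * y)))))"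
      unfolding h_def by (simp add: mult_ac del: of_nat_Suc mult_Suc mult_Suc_right)
  qed
  finally show "(\<lambda>m. chi2 (Suc m) * (\<Sum>i. chi1 (Suc i) * of_nat (Suc i) ^ k * of_real (exp (- (real (Suc i) * (real (Suc m) * y))))))
      sums eisenstein k chi1 chi2 y" .
qed

lemma eisenstein_iterated:
  fixes k :: nat
  assumes prim: "primitive_char p chi1" and np: "\<not> principal_char p chi1"
    and chi2: "dirichlet_char q chi2" and q: "q > 1" and y: "y > 0"
  defines "B \<equiv> (\<lambda>i j. \<Sum>r\<in>{1..<q}. \<Sum>s\<in>{1..<p}. chi2 r * (cnj (chi1 s) *
              lipschitz_kernel k (cnj (chi1 (p - 1))) (real (i * q + r) * y) (2 * pi / real p * real (j * p + s))))"
  shows "(\<lambda>i. \<Sum>j. fact k * gauss_sum p chi1 / of_nat p * B i j) sums eisenstein k chi1 chi2 y"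
proof -
  note chi1 = primitive_imp_dirichlet[OF prim]
  define c where "c = fact k * gauss_sum p chi1 / of_nat p"
  define A where "A = (\<lambda>w. \<Sum>i. chi1 (Suc i) * of_nat (Suc i) ^ k * complex_of_real (exp (- (real (Suc i) * w))))"
  have "(\<lambda>m. chi2 (Suc m) * A (real (Suc m) * y)) sums eisenstein k chi1 chi2 y"
    unfolding A_def by (rule summable_sigma_chi_exp(2)[OF chi1 chi2 y])
  hence "(\<lambda>m. chi2 m * A (real m * y)) sums eisenstein k chi1 chi2 y"
    by (subst (asm) sums_Suc_iff) (simp add: dirichlet_char_0[OF chi2 q])
  from sums_group[OF this, of q] q
  have "(\<lambda>i. \<Sum>m\<in>{i * q..<i * q + q}. chi2 m * A (real m * y)) sums eisenstein k chi1 chi2 y" by simp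
  also have "(\<lambda>i. \<Sum>m\<in>{i * q..<i * q + q}. chi2 m * A (real m * y)) = (\<lambda>i. \<Sum>j. c * B i j)"
  proof
    fix i
    have "(\<Sum>m\<in>{i * q..<i * q + q}. chi2 m * A (real m * y)) = (\<Sum>r<q. chi2 (i * q + r) * A (real (i * q + r) * y))"
      by (rule sum.reindex_bij_witness[of _ "\<lambda>r. i * q + r" "\<lambda>m. m - i * q"]) auto
    also have "\<dots> = (\<Sum>r<q. chi2 r * A (real (i * q + r) * y))"
      by (simp only: dirichlet_char_add_mult[OF chi2])
    also have "\<dots> = (\<Sum>r\<in>{1..<q}. chi2 r * A (real (i * q + r) * y))"
      by (rule sum_residues_from_1[OF chi2 q])
    finally have 1: "(\<Sum>m\<in>{i * q..<i * q + q}. chi2 m * A (real m * y)) = (\<Sum>r\<in>{1..<q}. chi2 r * A (real (i * q + r) * y))" .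
    have "(\<lambda>j. \<Sum>r\<in>{1..<q}. chi2 r * (c * (\<Sum>s\<in>{1..<p}. cnj (chi1 s) *
            lipschitz_kernel k (cnj (chi1 (p - 1))) (real (i * q + r) * y) (2 * pi * real (j * p + s) / real p))))
         sums (\<Sum>r\<in>{1..<q}. chi2 r * A (real (i * q + r) * y))"
    proof (intro sums_sum sums_mult)
      fix r assume r: "r \<in> {1..<q}"
      hence "real (i * q + r) * y > 0" using y by (auto intro!: mult_pos_pos add_nonneg_pos)
      thus "(\<lambda>j. c * (\<Sum>s\<in>{1..<p}. cnj (chi1 s) *
            lipschitz_kernel k (cnj (chi1 (p - 1))) (real (i * q + r) * y) (2 * pi * real (j * p + s) / real p)))
           sums A (real (i * q + r) * y)"
        unfolding c_def A_def by (rule twisted_lipschitz(2)[OF prim np])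
    qed
    also have "(\<lambda>j. \<Sum>r\<in>{1..<q}. chi2 r * (c * (\<Sum>s\<in>{1..<p}. cnj (chi1 s) *
            lipschitz_kernel k (cnj (chi1 (p - 1))) (real (i * q + r) * y) (2 * pi * real (j * p + s) / real p)))) =
        (\<lambda>j. c * B i j)"
      unfolding B_def sum_distrib_left by (simp add: mult_ac)
    finally show "(\<Sum>m\<in>{i * q..<i * q + q}. chi2 m * A (real m * y)) = (\<Sum>j. c * B i j)"
      using 1 by (simp add: sums_iff)
  qed
  finally show ?thesis unfolding c_def .
qed

lemma lipschitz_kernel_swap:
  assumes "even k" "\<epsilon> * \<epsilon> = 1" "c > 0"
  shows "lipschitz_kernel k (-\<epsilon>) (c * b) (c * a) = \<epsilon> / (of_real c * \<i>) ^ Suc k * lipschitz_kernel k \<epsilon> a b"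
proof -
  have 1: "Complex (c * b) (c * a) = (of_real c * \<i>) * Complex a (-b)"
    and 2: "Complex (c * b) (- (c * a)) = - (of_real c * \<i>) * Complex a b"
    by (simp_all add: complex_eq_iff)
  have odd: "(- z) ^ Suc k = - (z ^ Suc k)" for z :: complex using assms(1) by simp
  have "lipschitz_kernel k (-\<epsilon>) (c * b) (c * a) =
     1 / (of_real c * \<i>) ^ Suc k * (1 / Complex a (-b) ^ Suc k + \<epsilon> / Complex a b ^ Suc k)"
    unfolding lipschitz_kernel_def 1 2 power_mult_distrib[of _ "Complex _ _"] odd
    by (simp add: distrib_left del: power_Suc)
  also have "1 / Complex a (-b) ^ Suc k + \<epsilon> / Complex a b ^ Suc k = \<epsilon> * lipschitz_kernel k \<epsilon> a b"
    unfolding lipschitz_kernel_def distrib_left using assms(2) by (simp del: power_Suc)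
  finally show ?thesis by simp
qed

lemma primitive_char_cnj:
  assumes "primitive_char q chi" shows "primitive_char q (cnj \<circ> chi)"
  using assms dirichlet_char_cnj unfolding primitive_char_def by simp

lemma principal_char_cnj [simp]: "principal_char q (cnj \<circ> chi) \<longleftrightarrow> principal_char q chi"
  by (simp add: principal_char_def)

lemma eisenstein_transformation:
  assumes k: "even k"
    and prim: "primitive_char p chi1" "primitive_char q chi2"
    and np: "\<not> principal_char p chi1" "\<not> principal_char q chi2"
    and par: "chi1 (p - 1) = \<epsilon>" "chi2 (q - 1) = - \<epsilon>" "\<epsilon> = 1 \<or> \<epsilon> = -1"
    and y: "y > 0"
  shows "eisenstein k chi1 chi2 y = - (gauss_sum p chi1 * gauss_sum q chi2 / of_nat p *
     (of_real (2 * pi / (real q * y)) * \<i>) ^ Suc k) * eisenstein k (cnj \<circ> chi2) (cnj \<circ> chi1) (4 * pi\<^sup>2 / (real p * real q * y))"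
proof -
  note chi = primitive_imp_dirichlet[OF prim(1)] primitive_imp_dirichlet[OF prim(2)]
  have p: "p > 1" and q: "q > 1"
    using nonprincipal_modulus_gt_1 chi np by blast+
  have chi0: "(\<Sum>r\<in>{1..<n}. c r) = 0" if "dirichlet_char n c" "\<not> principal_char n c" for n c
    using sum_residues_from_1[OF that(1) nonprincipal_modulus_gt_1[OF that], of "\<lambda>_. 1"]
      dirichlet_char_sum_eq_0[OF that] by simp
  define c where "c = 2 * pi / (real q * y)"
  have c: "c > 0" unfolding c_def using y q by simp
  define y' where "y' = 4 * pi\<^sup>2 / (real p * real q * y)"
  have y': "y' > 0" unfolding y'_def using y p q by simp
  have eps: "\<epsilon> * \<epsilon> = 1" "cnj \<epsilon> = \<epsilon>" "norm \<epsilon> \<le> 1" "\<epsilon> \<noteq> 0" using par(3) by auto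
  define B where "B = (\<lambda>i j. \<Sum>r\<in>{1..<q}. \<Sum>s\<in>{1..<p}. chi2 r * (cnj (chi1 s) *
              lipschitz_kernel k \<epsilon> (real (i * q + r) * y) (2 * pi / real p * real (j * p + s))))"
  define c1 c2 where "c1 = fact k * gauss_sum p chi1 / of_nat p" and "c2 = fact k * gauss_sum q (cnj \<circ> chi2) / of_nat q"
  define K where "K = \<epsilon> / (of_real c * \<i>) ^ Suc k"
  obtain C where C: "C \<ge> 0" "\<And>i j. norm (B i j) \<le> C * (1 / sqrt (real (Suc i)) ^ 3) * (1 / sqrt (real (Suc j)) ^ 3)"
  proof (rule kernel_block_bound[of chi2 q "\<lambda>s. cnj (chi1 s)" p \<epsilon> y "2 * pi / real p" k])
    show "(\<Sum>s\<in>{1..<p}. cnj (chi1 s)) = 0"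
      using chi0[OF dirichlet_char_cnj[OF chi(1)]] np(1) by simp
  qed (use p q y eps chi0[OF chi(2) np(2)] dirichlet_char_norm_le[OF chi(1)] dirichlet_char_norm_le[OF chi(2)] in \<open>auto simp: B_def\<close>)
  let ?v = "\<lambda>j. 1 / sqrt (real (Suc j)) ^ 3"
  let ?u = "\<lambda>i. C * ?v i"
  have u: "summable ?u" "\<And>i. ?u i \<ge> 0" and v: "summable ?v" "\<And>i. ?v i \<ge> 0"
    using summable_mult[OF summable_inverse_sqrt_cubed, of C] summable_inverse_sqrt_cubed C(1) by simp_all
  define S where "S = infsum (\<lambda>(i,j). B i j) (UNIV \<times> UNIV)"
  have rows: "(\<lambda>i. \<Sum>j. B i j) sums S" "\<And>i. summable (\<lambda>j. B i j)"
    and cols: "(\<lambda>j. \<Sum>i. B i j) sums S" "\<And>j. summable (\<lambda>i. B i j)"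
    unfolding S_def using iterated_sums_swap[of B ?u ?v, OF C(2) u v] by blast+
  have "(\<lambda>i. \<Sum>j. c1 * B i j) sums eisenstein k chi1 chi2 y"
    unfolding B_def c1_def using eisenstein_iterated[OF prim(1) np(1) chi(2) q y, of k] par(1) eps(2) by simp
  moreover have "(\<lambda>i. \<Sum>j. c1 * B i j) sums (c1 * S)"
    using sums_mult[OF rows(1), of c1] by (simp add: suminf_mult rows)
  ultimately have F: "eisenstein k chi1 chi2 y = c1 * S" by (rule sums_unique2)
  have "(\<lambda>j. \<Sum>i. c2 * (\<Sum>s\<in>{1..<p}. \<Sum>r\<in>{1..<q}. cnj (chi1 s) * (chi2 r *
              lipschitz_kernel k (-\<epsilon>) (real (j * p + s) * y') (2 * pi / real q * real (i * q + r)))))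
     sums eisenstein k (cnj \<circ> chi2) (cnj \<circ> chi1) y'"
    unfolding c2_def using eisenstein_iterated[OF primitive_char_cnj[OF prim(2)] _ dirichlet_char_cnj[OF chi(1)] p y', of k] par(2) np(2) by simp
  also have "(\<lambda>j. \<Sum>i. c2 * (\<Sum>s\<in>{1..<p}. \<Sum>r\<in>{1..<q}. cnj (chi1 s) * (chi2 r *
              lipschitz_kernel k (-\<epsilon>) (real (j * p + s) * y') (2 * pi / real q * real (i * q + r)))))
     = (\<lambda>j. \<Sum>i. c2 * K * B i j)"
  proof (intro ext suminf_cong)
    fix i j
    have "lipschitz_kernel k (-\<epsilon>) (real (j * p + s) * y') (2 * pi / real q * real (i * q + r)) =
       K * lipschitz_kernel k \<epsilon> (real (i * q + r) * y) (2 * pi / real p * real (j * p + s))" for r s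
    proof -
      have "real (j * p + s) * y' = c * (2 * pi / real p * real (j * p + s))"
        by (simp add: c_def y'_def power2_eq_square mult_ac)
      moreover have "2 * pi / real q * real (i * q + r) = c * (real (i * q + r) * y)"
        using y by (simp add: c_def)
      ultimately show ?thesis unfolding K_def by (simp only: lipschitz_kernel_swap[OF k eps(1) c])
    qed
    thus "c2 * (\<Sum>s\<in>{1..<p}. \<Sum>r\<in>{1..<q}. cnj (chi1 s) * (chi2 r *
              lipschitz_kernel k (-\<epsilon>) (real (j * p + s) * y') (2 * pi / real q * real (i * q + r)))) = c2 * K * B i j"
      unfolding B_def by (subst sum.swap) (simp add: sum_distrib_left mult_ac)
  qed
  finally have "(\<lambda>j. \<Sum>i. c2 * K * B i j) sums eisenstein k (cnj \<circ> chi2) (cnj \<circ> chi1) y'" .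
  moreover have "(\<lambda>j. \<Sum>i. c2 * K * B i j) sums (c2 * K * S)"
    using sums_mult[OF cols(1), of "c2 * K"] by (simp add: suminf_mult cols)
  ultimately have G: "eisenstein k (cnj \<circ> chi2) (cnj \<circ> chi1) y' = c2 * K * S" by (rule sums_unique2)
  have tau: "gauss_sum q chi2 * gauss_sum q (cnj \<circ> chi2) = - \<epsilon> * of_nat q"
    using gauss_sum_mult_cnj[OF prim(2)] par(2) by simp
  have "- (gauss_sum p chi1 * gauss_sum q chi2 / of_nat p * (of_real c * \<i>) ^ Suc k) * (c2 * K)
      = - (fact k * gauss_sum p chi1 / of_nat p / of_nat q * \<epsilon> * (gauss_sum q chi2 * gauss_sum q (cnj \<circ> chi2)))"
    unfolding c2_def K_def using c by (simp add: field_simps del: power_Suc)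
  also have "\<dots> = c1 * (\<epsilon> * \<epsilon>)"
    unfolding tau c1_def using q by simp
  finally have *: "- (gauss_sum p chi1 * gauss_sum q chi2 / of_nat p * (of_real c * \<i>) ^ Suc k) * (c2 * K) = c1"
    using eps(1) by simp
  have "c1 * S = - (gauss_sum p chi1 * gauss_sum q chi2 / of_nat p * (of_real c * \<i>) ^ Suc k) * (c2 * K * S)"
    unfolding *[symmetric] by (simp only: mult.assoc)
  thus ?thesis unfolding F G[symmetric] y'_def[symmetric] c_def[symmetric] .
qed

section \<open>Integral representations\<close>

lemma powr_of_pos_real: "r > 0 \<Longrightarrow> complex_of_real r powr s = exp (s * of_real (ln r))"
  by (simp add: powr_def Ln_of_real)

lemma Gamma_integral_exp:
  fixes s :: complex
  assumes s: "Re s > 0"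
  shows "integrable lborel (\<lambda>v. of_real (exp (- exp v)) * exp (s * of_real v))"
    and "(\<integral>v. of_real (exp (- exp v)) * exp (s * of_real v) \<partial>lborel) = Gamma s"
proof -
  define f where "f = (\<lambda>t. complex_of_real t powr (s - 1) / of_real (exp t))"
  have img: "range exp = {0::real<..}"
    by (auto simp: image_iff) (metis exp_ln)
  have "f absolutely_integrable_on {0<..}"
    unfolding f_def by (rule absolutely_integrable_Gamma_integral'[OF s])
  moreover have "integral {0<..} f = Gamma s"
    unfolding f_def by (rule integral_unique[OF Gamma_integral_complex'[OF s]])
  ultimately have "(\<lambda>v. \<bar>exp v\<bar> *\<^sub>R f (exp v)) absolutely_integrable_on UNIV \<and>
      integral UNIV (\<lambda>v. \<bar>exp v\<bar> *\<^sub>R f (exp v)) = Gamma s"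
    by (subst has_absolute_integral_change_of_variables_real[where g = exp])
       (auto simp: img inj_on_def intro!: derivative_eq_intros)
  also have "(\<lambda>v. \<bar>exp v\<bar> *\<^sub>R f (exp v)) = (\<lambda>v. of_real (exp (- exp v)) * exp (s * of_real v))"
  proof
    fix v :: real
    have "\<bar>exp v\<bar> *\<^sub>R f (exp v) = exp (of_real v) * exp ((s - 1) * of_real v) * of_real (exp (- exp v))"
      unfolding f_def by (simp add: powr_of_pos_real scaleR_conv_of_real exp_minus divide_inverse exp_of_real)
    also have "exp (of_real v) * exp ((s - 1) * of_real v) = exp (s * of_real v)"
      by (simp add: algebra_simps flip: exp_add)
    finally show "\<bar>exp v\<bar> *\<^sub>R f (exp v) = of_real (exp (- exp v)) * exp (s * of_real v)"
      by (simp add: mult.commute)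
  qed
  finally have *: "(\<lambda>v. of_real (exp (- exp v)) * exp (s * of_real v)) absolutely_integrable_on UNIV"
    "integral UNIV (\<lambda>v. of_real (exp (- exp v)) * exp (s * of_real v)) = Gamma s" by auto
  have meas: "(\<lambda>v. of_real (exp (- exp v)) * exp (s * of_real v)) \<in> borel_measurable lborel"
    by measurable
  show "integrable lborel (\<lambda>v. of_real (exp (- exp v)) * exp (s * of_real v))"
    using *(1) by (simp add: set_integrable_def integrable_completion[OF meas])
  show "(\<integral>v. of_real (exp (- exp v)) * exp (s * of_real v) \<partial>lborel) = Gamma s"
    using set_lebesgue_integral_eq_integral(2)[OF *(1)] *(2)
    by (simp add: set_lebesgue_integral_def integral_completion[OF meas])
qed

lemma Gamma_integral_exp_scaled:
  fixes s :: complex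
  assumes s: "Re s > 0" and c: "c > 0"
  shows "integrable lborel (\<lambda>v. of_real (exp (- (c * exp v))) * exp (s * of_real v))"
    and "(\<integral>v. of_real (exp (- (c * exp v))) * exp (s * of_real v) \<partial>lborel) = Gamma s / of_real c powr s"
proof -
  define f where "f = (\<lambda>v. complex_of_real (exp (- exp v)) * exp (s * of_real v))"
  have eq: "f (ln c + 1 * v) = of_real c powr s * (of_real (exp (- (c * exp v))) * exp (s * of_real v))" for v
    using c by (simp add: f_def powr_of_pos_real exp_add distrib_left exp_of_real mult_ac)
  have nz: "of_real c powr s \<noteq> 0" using c by (simp add: powr_of_pos_real)
  have "integrable lborel (\<lambda>v. f (ln c + 1 * v))"
    by (rule lborel_integrable_real_affine) (use Gamma_integral_exp[OF s] in \<open>auto simp: f_def\<close>)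
  hence "integrable lborel (\<lambda>v. inverse (of_real c powr s) *
      (of_real c powr s * (of_real (exp (- (c * exp v))) * exp (s * of_real v))))"
    unfolding eq by (rule integrable_mult_right)
  thus "integrable lborel (\<lambda>v. of_real (exp (- (c * exp v))) * exp (s * of_real v))"
    unfolding mult.assoc[symmetric] left_inverse[OF nz] by simp
  have "Gamma s = (\<integral>v. f v \<partial>lborel)"
    unfolding f_def using Gamma_integral_exp[OF s] by simp
  also have "\<dots> = (\<integral>v. f (ln c + 1 * v) \<partial>lborel)"
    by (subst lborel_integral_real_affine[where c = 1 and t = "ln c"]) auto
  finally show "(\<integral>v. of_real (exp (- (c * exp v))) * exp (s * of_real v) \<partial>lborel) = Gamma s / of_real c powr s"
    unfolding eq using nz by simp
qed

lemma integrable_bessel_integrand: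
  fixes \<nu> :: complex
  assumes "Re \<nu> > 0" "c \<ge> 0"
  shows "integrable lborel (\<lambda>v. of_real (exp (- exp v - c * exp (- v))) * exp (\<nu> * of_real v))"
proof (rule Bochner_Integration.integrable_bound[OF Gamma_integral_exp(1)[OF assms(1)]])
  show "AE v in lborel. norm (complex_of_real (exp (- exp v - c * exp (- v))) * exp (\<nu> * of_real v))
      \<le> norm (complex_of_real (exp (- exp v)) * exp (\<nu> * of_real v))"
    using assms by (intro AE_I2) (auto simp: norm_mult intro!: mult_right_mono)
qed measurable

lemma besselK_integral:
  fixes \<nu> :: complex
  assumes \<nu>: "Re \<nu> > 0" and z: "z > 0"
  shows "besselK \<nu> z = 1 / 2 / of_real (z / 2) powr \<nu> *
     (\<integral>v. of_real (exp (- exp v - z\<^sup>2 / 4 * exp (- v))) * exp (\<nu> * of_real v) \<partial>lborel)"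
proof -
  define h where "h = (\<lambda>v. complex_of_real (exp (- exp v - z\<^sup>2 / 4 * exp (- v))) * exp (\<nu> * of_real v))"
  define g where "g = (\<lambda>t. complex_of_real (exp (- z * cosh t)) * exp (\<nu> * of_real t))"
  have hint: "integrable lborel h"
    unfolding h_def by (rule integrable_bessel_integrand[OF \<nu>]) simp
  have eq: "h (ln (z / 2) + 1 * t) = of_real (z / 2) powr \<nu> * g t" for t
  proof -
    have "- exp (ln (z / 2) + t) - z\<^sup>2 / 4 * exp (- (ln (z / 2) + t)) = - z * cosh t"
    proof -
      have "exp (ln (z / 2) + t) = z / 2 * exp t" "exp (- (ln (z / 2) + t)) = 2 / z * exp (- t)"
        using z by (simp_all add: exp_add exp_diff exp_minus field_simps)
      thus ?thesis using z by (simp add: cosh_field_def field_simps power2_eq_square)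
    qed
    moreover have "exp (\<nu> * of_real (ln (z / 2) + t)) = of_real (z / 2) powr \<nu> * exp (\<nu> * of_real t)"
      using z by (subst powr_of_pos_real) (simp_all add: distrib_left flip: exp_add)
    ultimately show ?thesis unfolding h_def g_def by (simp add: mult_ac)
  qed
  have nz: "of_real (z / 2) powr \<nu> \<noteq> 0" using z by (subst powr_of_pos_real) auto
  have "integrable lborel (\<lambda>t. h (ln (z / 2) + 1 * t))"
    by (rule lborel_integrable_real_affine) (use hint in auto)
  hence "integrable lborel (\<lambda>t. inverse (of_real (z / 2) powr \<nu>) * (of_real (z / 2) powr \<nu> * g t))"
    unfolding eq by (rule integrable_mult_right)
  hence gint: "integrable lborel g"
    unfolding mult.assoc[symmetric] left_inverse[OF nz] by simp
  have "(\<integral>v. h v \<partial>lborel) = (\<integral>t. h (ln (z / 2) + 1 * t) \<partial>lborel)"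
    by (subst lborel_integral_real_affine[where c = 1 and t = "ln (z / 2)"]) auto
  also have "\<dots> = of_real (z / 2) powr \<nu> * (\<integral>t. g t \<partial>lborel)"
    unfolding eq by simp
  finally have 1: "(\<integral>v. h v \<partial>lborel) = of_real (z / 2) powr \<nu> * (\<integral>t. g t \<partial>lborel)" .
  have si: "set_integrable lborel A g" if "A \<in> sets borel" for A
    unfolding set_integrable_def using integrable_mult_indicator[OF _ gint, of A] that by simp
  have refl: "(LBINT t:{0..}. g (- t)) = (LBINT t:{..0}. g t)"
    by (subst (2) set_integral_reflect) (simp add: atLeast_def)
  have "integrable lborel (\<lambda>t. g (0 + (-1) * t))"
    by (rule lborel_integrable_real_affine[OF gint]) simp
  hence gm: "set_integrable lborel {0..} (\<lambda>t. g (- t))"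
    unfolding set_integrable_def by (intro integrable_mult_indicator) simp_all
  have "besselK \<nu> z = (LBINT t:{0..}. 1 / 2 * (g t + g (- t)))"
  proof -
    have "of_real (exp (- z * cosh t)) * cosh (\<nu> * of_real t) = 1 / 2 * (g t + g (- t))" for t
      unfolding g_def cosh_field_def[where z = "\<nu> * of_real t"] by (simp add: algebra_simps)
    thus ?thesis unfolding besselK_def by (simp only:)
  qed
  also have "\<dots> = 1 / 2 * ((LBINT t:{0..}. g t) + (LBINT t:{0..}. g (- t)))"
    using set_integral_add(2)[OF si gm] by simp
  also have "(LBINT t:{0..}. g t) + (LBINT t:{0..}. g (- t)) = (LBINT t:{0..} \<union> {..0}. g t)"
    unfolding refl
  proof (rule set_integral_Un_AE[symmetric])
    show "AE t in lborel. \<not> (t \<in> {0..} \<and> t \<in> {..0::real})"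
      using AE_lborel_singleton[of 0] by eventually_elim auto
  qed (use si in auto)
  also have "{0..} \<union> {..0} = (UNIV :: real set)" by auto
  also have "(LBINT t:UNIV. g t) = (\<integral>t. g t \<partial>lborel)"
    by (simp add: set_lebesgue_integral_def)
  finally show ?thesis using 1 nz unfolding h_def by simp
qed

lemma norm_sigma_chi_le:
  assumes "dirichlet_char p chi1" "dirichlet_char q chi2" "n > 0"
  shows "norm (sigma_chi (of_nat k) chi1 chi2 n) \<le> (\<Sum>d | d dvd n. real d ^ k)"
  unfolding sigma_chi_conv[OF assms(3)]
proof (rule sum_norm_le)
  fix d
  have "norm (of_nat d ^ k * chi1 d * chi2 (n div d)) = real d ^ k * norm (chi1 d) * norm (chi2 (n div d))"
    by (simp add: norm_mult norm_power)
  also have "\<dots> \<le> real d ^ k * 1 * 1"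
    by (intro mult_mono dirichlet_char_norm_le[OF assms(1)] dirichlet_char_norm_le[OF assms(2)]) auto
  finally show "norm (of_nat d ^ k * chi1 d * chi2 (n div d)) \<le> real d ^ k" by simp
qed

lemma norm_sigma_chi_le_power:
  assumes "dirichlet_char p chi1" "dirichlet_char q chi2" "n > 0"
  shows "norm (sigma_chi (of_nat k) chi1 chi2 n) \<le> real n ^ Suc k"
proof -
  have sub: "{d. d dvd n} \<subseteq> {1..n}" using assms(3) by (auto intro: dvd_imp_le Nat.gr0I simp: Suc_le_eq)
  have "norm (sigma_chi (of_nat k) chi1 chi2 n) \<le> (\<Sum>d | d dvd n. real d ^ k)"
    by (rule norm_sigma_chi_le[OF assms])
  also have "\<dots> \<le> (\<Sum>d\<in>{1..n}. real d ^ k)"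
    by (rule sum_mono2) (use sub in auto)
  also have "\<dots> \<le> (\<Sum>d\<in>{1..n}. real n ^ k)"
    by (intro sum_mono power_mono) auto
  finally show ?thesis by simp
qed

lemma summable_sigma_chi_powr:
  assumes "dirichlet_char p chi1" "dirichlet_char q chi2" and t: "t > real k + 1"
  shows "summable (\<lambda>n. norm (sigma_chi (of_nat k) chi1 chi2 (Suc n)) * real (Suc n) powr (- t))"
proof -
  define h where "h = (\<lambda>d m::nat. real d ^ k * real (d * m) powr (- t))"
  have "summable (\<lambda>n. \<Sum>d | d dvd Suc n. norm (h d (Suc n div d)))"
  proof (rule divisor_sum_sums(1))
    show "norm (h (Suc i) (Suc j)) \<le> real (Suc i) powr (real k - t) * real (Suc j) powr (- t)" for i j
      unfolding h_def of_nat_mult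
      by (simp add: powr_mult powr_diff powr_minus powr_realpow divide_inverse del: of_nat_Suc)
    show "summable (\<lambda>i. real (Suc i) powr (real k - t))" "summable (\<lambda>j. real (Suc j) powr (- t))"
      using t by (subst summable_Suc_iff, simp add: summable_real_powr_iff)+
  qed auto
  moreover have "norm (norm (sigma_chi (of_nat k) chi1 chi2 (Suc n)) * real (Suc n) powr (- t))
      \<le> (\<Sum>d | d dvd Suc n. norm (h d (Suc n div d)))" for n
  proof -
    have "norm (norm (sigma_chi (of_nat k) chi1 chi2 (Suc n)) * real (Suc n) powr (- t))
        = norm (sigma_chi (of_nat k) chi1 chi2 (Suc n)) * real (Suc n) powr (- t)" by simp
    also have "\<dots> \<le> (\<Sum>d | d dvd Suc n. real d ^ k) * real (Suc n) powr (- t)"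
      by (intro mult_right_mono norm_sigma_chi_le[OF assms(1,2)]) auto
    also have "\<dots> = (\<Sum>d | d dvd Suc n. norm (h d (Suc n div d)))"
      unfolding sum_distrib_right h_def
      by (intro sum.cong refl) (auto simp del: of_nat_Suc)
    finally show ?thesis .
  qed
  ultimately show ?thesis by (rule summable_comparison_test'[where N = 0])
qed

lemma exp_minus_le_inverse_power:
  fixes u :: real
  assumes "u > 0" shows "exp (- u) \<le> fact N / u ^ N"
proof -
  have "(\<lambda>n. u ^ n /\<^sub>R fact n) sums exp u" by (rule exp_converges)
  hence "u ^ N /\<^sub>R fact N \<le> exp u"
    using sum_le_suminf[of "\<lambda>n. u ^ n /\<^sub>R fact n" "{N}"] assms by (simp add: sums_iff)
  thus ?thesis using assms by (simp add: exp_minus field_simps)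
qed

lemma bessel_series_integral:
  fixes \<nu> :: complex
  assumes chi: "dirichlet_char p chi1" "dirichlet_char q chi2" and \<nu>: "Re \<nu> > 0" and c: "c > 0"
  shows "(\<lambda>n. sigma_chi (of_nat k) chi1 chi2 (Suc n) *
      (\<integral>v. of_real (exp (- exp v - real (Suc n) * c * exp (- v))) * exp (\<nu> * of_real v) \<partial>lborel))
    sums (\<integral>v. of_real (exp (- exp v)) * exp (\<nu> * of_real v) * eisenstein k chi1 chi2 (c * exp (- v)) \<partial>lborel)"
proof -
  define \<sigma> where "\<sigma> = (\<lambda>n. sigma_chi (of_nat k) chi1 chi2 (Suc n))"
  define f where "f = (\<lambda>n v. \<sigma> n * (complex_of_real (exp (- exp v - real (Suc n) * c * exp (- v))) * exp (\<nu> * of_real v)))"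
  have E: "eisenstein k chi1 chi2 y = (\<Sum>n. \<sigma> n * of_real (exp (- (real (Suc n) * y))))" for y
    by (simp only: eisenstein_def \<sigma>_def)
  have int: "integrable lborel (f n)" for n
    unfolding f_def by (intro integrable_mult_right integrable_bessel_integrand \<nu>) (use c in simp)
  have f_eq: "f n v = of_real (exp (- exp v)) * exp (\<nu> * of_real v) *
      (\<sigma> n * of_real (exp (- (real (Suc n) * (c * exp (- v))))))" for n v
    unfolding f_def by (simp add: exp_diff exp_minus divide_inverse mult_ac)
  have sm: "summable (\<lambda>n. norm (\<sigma> n * of_real (exp (- (real (Suc n) * (c * exp (- v)))))))" for v
    unfolding \<sigma>_def by (rule summable_sigma_chi_exp(1)[OF chi]) (use c in simp)
  have ae: "AE v in lborel. summable (\<lambda>n. norm (f n v))"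
    unfolding f_eq norm_mult[of "_ * exp _"] by (intro AE_I2 summable_mult sm)
  define N where "N = k + 3"
  define g where "g = (\<lambda>v. norm (complex_of_real (exp (- exp v)) * exp ((\<nu> + of_nat N) * of_real v)))"
  have g: "integrable lborel g"
    unfolding g_def by (intro integrable_norm Gamma_integral_exp(1)) (use \<nu> in simp)
  define M where "M = fact N / c ^ N"
  have bound: "norm (f n v) \<le> M * (1 / real (Suc n) ^ 2) * g v" for n v
  proof -
    have pos: "real (Suc n) * (c * exp (- v)) > 0" using c by simp
    have "norm (f n v) = norm (complex_of_real (exp (- exp v)) * exp (\<nu> * of_real v)) *
       (norm (\<sigma> n) * exp (- (real (Suc n) * (c * exp (- v)))))"
      unfolding f_eq norm_mult norm_of_real abs_exp_cancel ..
    also have "\<dots> \<le> norm (complex_of_real (exp (- exp v)) * exp (\<nu> * of_real v)) *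
       (real (Suc n) ^ Suc k * (fact N / (real (Suc n) * (c * exp (- v))) ^ N))"
      unfolding \<sigma>_def
      by (intro mult_left_mono mult_mono norm_sigma_chi_le_power[OF chi] exp_minus_le_inverse_power pos) (use pos in auto)
    also have "real (Suc n) ^ Suc k * (fact N / (real (Suc n) * (c * exp (- v))) ^ N) =
        M * (1 / real (Suc n) ^ 2) * exp v ^ N"
      using c unfolding N_def M_def power_mult_distrib
      by (simp add: power_add exp_minus field_simps eval_nat_numeral del: of_nat_Suc)
    also have "norm (complex_of_real (exp (- exp v)) * exp (\<nu> * of_real v)) * (M * (1 / real (Suc n) ^ 2) * exp v ^ N)
        = M * (1 / real (Suc n) ^ 2) * g v"
      unfolding g_def norm_mult distrib_right exp_add exp_of_nat_mult[symmetric]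
      by (simp add: norm_mult mult_ac)
    finally show ?thesis .
  qed
  have isum: "summable (\<lambda>n. \<integral>v. norm (f n v) \<partial>lborel)"
  proof (rule summable_comparison_test')
    have "summable (\<lambda>n. M * (1 / real (Suc n) ^ 2) * (\<integral>v. g v \<partial>lborel))"
      using inverse_power_summable[of 2, where 'a = real]
      by (intro summable_mult summable_mult2) (subst summable_Suc_iff, simp add: inverse_eq_divide)
    thus "summable (\<lambda>n. \<integral>v. M * (1 / real (Suc n) ^ 2) * g v \<partial>lborel)" by simp
    show "norm (\<integral>v. norm (f n v) \<partial>lborel) \<le> (\<integral>v. M * (1 / real (Suc n) ^ 2) * g v \<partial>lborel)" for n
      unfolding real_norm_def abs_of_nonneg[OF integral_nonneg_AE[OF AE_I2[OF norm_ge_zero]]]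
      by (intro integral_mono integrable_norm int integrable_mult_right g bound)
  qed
  have "(\<lambda>n. \<integral>v. f n v \<partial>lborel) sums (\<integral>v. (\<Sum>n. f n v) \<partial>lborel)"
    by (rule sums_integral[OF int ae isum])
  also have "(\<lambda>v. \<Sum>n. f n v) = (\<lambda>v. of_real (exp (- exp v)) * exp (\<nu> * of_real v) * eisenstein k chi1 chi2 (c * exp (- v)))"
    unfolding f_eq E by (intro ext suminf_mult summable_norm_cancel[OF sm])
  finally show ?thesis unfolding f_def \<sigma>_def by simp
qed

lemma gamma_series_integral:
  fixes s :: complex
  assumes chi: "dirichlet_char p chi1" "dirichlet_char q chi2" and s: "Re s > real k + 1" and X: "X > 0"
  shows "(\<lambda>n. sigma_chi (of_nat k) chi1 chi2 (Suc n) * (Gamma s / of_real (1 + real (Suc n) / X) powr s))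
    sums (\<integral>v. of_real (exp (- exp v)) * exp (s * of_real v) * eisenstein k chi1 chi2 (exp v / X) \<partial>lborel)"
proof -
  define \<sigma> where "\<sigma> = (\<lambda>n. sigma_chi (of_nat k) chi1 chi2 (Suc n))"
  define f where "f = (\<lambda>n v. \<sigma> n * (complex_of_real (exp (- ((1 + real (Suc n) / X) * exp v))) * exp (s * of_real v)))"
  have pos: "1 + real (Suc n) / X > 0" for n using X by (simp add: add_pos_nonneg)
  have s0: "Re s > 0" using s by (rule order_le_less_trans[rotated]) simp
  have E: "eisenstein k chi1 chi2 y = (\<Sum>n. \<sigma> n * of_real (exp (- (real (Suc n) * y))))" for y
    by (simp only: eisenstein_def \<sigma>_def)
  have int: "integrable lborel (f n)" for n
    unfolding f_def by (intro integrable_mult_right Gamma_integral_exp_scaled s0 pos)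
  have f_eq: "f n v = of_real (exp (- exp v)) * exp (s * of_real v) *
      (\<sigma> n * of_real (exp (- (real (Suc n) * (exp v / X)))))" for n v
  proof -
    have "exp (- ((1 + real (Suc n) / X) * exp v)) = exp (- exp v) * exp (- (real (Suc n) * (exp v / X)))"
      unfolding exp_add[symmetric] by (simp add: algebra_simps)
    thus ?thesis unfolding f_def by (simp add: mult_ac)
  qed
  have sm: "summable (\<lambda>n. norm (\<sigma> n * of_real (exp (- (real (Suc n) * (exp v / X))))))" for v
    unfolding \<sigma>_def by (rule summable_sigma_chi_exp(1)[OF chi]) (use X in simp)
  have ae: "AE v in lborel. summable (\<lambda>n. norm (f n v))"
    unfolding f_eq norm_mult[of "_ * exp _"] by (intro AE_I2 summable_mult sm)
  define I where "I = (\<lambda>n. \<integral>v. norm (f n v) \<partial>lborel)"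
  have I: "I n = norm (\<sigma> n) * norm (Gamma (of_real (Re s) :: complex)) * (1 + real (Suc n) / X) powr (- Re s)" for n
  proof -
    have "complex_of_real (I n) = (\<integral>v. of_real (norm (\<sigma> n)) * (complex_of_real (exp (- ((1 + real (Suc n) / X) * exp v))) * exp (of_real (Re s) * of_real v)) \<partial>lborel)"
      unfolding I_def f_def integral_complex_of_real[symmetric] norm_mult
      by (simp add: exp_of_real flip: of_real_mult)
    also have "\<dots> = of_real (norm (\<sigma> n)) * (Gamma (of_real (Re s)) / of_real (1 + real (Suc n) / X) powr of_real (Re s))"
      by (subst integral_mult_right_zero, subst Gamma_integral_exp_scaled(2)) (use s0 pos in auto)
    also have "complex_of_real (1 + real (Suc n) / X) powr of_real (Re s) = of_real ((1 + real (Suc n) / X) powr Re s)"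
      by (rule powr_of_real) (use pos[of n] in simp_all)
    finally have "norm (complex_of_real (I n)) = norm (of_real (norm (\<sigma> n)) *
        (Gamma (of_real (Re s)) / complex_of_real ((1 + real (Suc n) / X) powr Re s)))"
      by (rule arg_cong)
    also have "\<dots> = norm (\<sigma> n) * (norm (Gamma (of_real (Re s) :: complex)) / (1 + real (Suc n) / X) powr Re s)"
      unfolding norm_mult norm_divide norm_of_real by simp
    finally have "norm (complex_of_real (I n)) = norm (\<sigma> n) * (norm (Gamma (of_real (Re s) :: complex)) / (1 + real (Suc n) / X) powr Re s)" .
    moreover have "I n \<ge> 0" unfolding I_def by simp
    ultimately show ?thesis by (simp add: powr_minus_divide)
  qed
  have isum: "summable I"
  proof (rule summable_comparison_test')
    show "summable (\<lambda>n. norm (Gamma (of_real (Re s) :: complex)) * X powr (Re s) * (norm (\<sigma> n) * real (Suc n) powr (- Re s)))"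
      unfolding \<sigma>_def by (intro summable_mult summable_sigma_chi_powr[OF chi s])
    fix n
    have "(1 + real (Suc n) / X) powr (- Re s) \<le> (real (Suc n) / X) powr (- Re s)"
      using X s0 by (intro powr_mono2') auto
    also have "\<dots> = X powr (Re s) * real (Suc n) powr (- Re s)"
      using X by (simp add: powr_divide powr_minus_divide del: of_nat_Suc)
    finally have "I n \<le> norm (\<sigma> n) * norm (Gamma (of_real (Re s) :: complex)) * (X powr (Re s) * real (Suc n) powr (- Re s))"
      unfolding I by (intro mult_left_mono) auto
    moreover have "I n \<ge> 0" unfolding I_def by simp
    ultimately show "norm (I n) \<le> norm (Gamma (of_real (Re s) :: complex)) * X powr (Re s) * (norm (\<sigma> n) * real (Suc n) powr (- Re s))"
      by (simp add: mult_ac)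
  qed
  have "(\<lambda>n. \<integral>v. f n v \<partial>lborel) sums (\<integral>v. (\<Sum>n. f n v) \<partial>lborel)"
    by (rule sums_integral[OF int ae isum[unfolded I_def]])
  also have "(\<lambda>v. \<Sum>n. f n v) = (\<lambda>v. of_real (exp (- exp v)) * exp (s * of_real v) * eisenstein k chi1 chi2 (exp v / X))"
    unfolding f_eq E by (intro ext suminf_mult summable_norm_cancel[OF sm])
  also have "(\<lambda>n. \<integral>v. f n v \<partial>lborel) = (\<lambda>n. \<sigma> n * (Gamma s / of_real (1 + real (Suc n) / X) powr s))"
    unfolding f_def by (subst integral_mult_right_zero, subst Gamma_integral_exp_scaled(2)) (use s0 pos in auto)
  finally show ?thesis unfolding \<sigma>_def .
qed

lemma transformation_constant:
  fixes a x :: real and \<nu> g :: complex and p q k :: nat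
  assumes "even k" "a > 0" "x > 0" "p > 0" "q > 0"
  shows "1 / 2 / of_real (a * sqrt x / 2) powr \<nu> *
     (- (g / of_nat p * (of_real (2 * pi / (real q * (a\<^sup>2 * x / 4))) * \<i>) ^ Suc k)) *
     of_real (a\<^sup>2 * p * q * x / (16 * pi\<^sup>2)) powr (\<nu> + k + 1) =
   (-1) ^ (k div 2) * complex_of_real (a * q) powr \<nu> * of_nat p powr (\<nu> + k) * complex_of_real x powr (\<nu> / 2)
           / (\<i> * 2 powr (3 * \<nu> + k + 2) * complex_of_real pi powr (2 * \<nu> + k + 1)) * g"
proof -
  define A X P Q Z T where "A = complex_of_real (ln a)" and "X = complex_of_real (ln x)"
    and "P = complex_of_real (ln (real p))" and "Q = complex_of_real (ln (real q))"
    and "Z = complex_of_real (ln pi)" and "T = complex_of_real (ln 2)"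
  note defs = A_def X_def P_def Q_def Z_def T_def
  have ln8: "ln 8 = 3 * ln (2::real)" and ln16: "ln 16 = 4 * ln (2::real)"
    using ln_realpow[of 2 3] ln_realpow[of 2 4] by simp_all
  have 1: "of_real (a * sqrt x / 2) powr \<nu> = exp (\<nu> * (A + X / 2 - T))"
    using assms by (subst powr_of_pos_real) (simp_all add: defs ln_mult ln_div ln_sqrt)
  have 2: "of_real (a\<^sup>2 * p * q * x / (16 * pi\<^sup>2)) powr (\<nu> + k + 1) =
      exp ((\<nu> + k + 1) * (2 * A + P + Q + X - 4 * T - 2 * Z))"
    using assms by (subst powr_of_pos_real) (simp_all add: defs ln_mult ln_div ln_realpow ln16 algebra_simps)
  have "of_real (2 * pi / (real q * (a\<^sup>2 * x / 4))) = exp (complex_of_real (ln (2 * pi / (real q * (a\<^sup>2 * x / 4)))))"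
    using assms unfolding exp_of_real by (subst exp_ln) auto
  also have "complex_of_real (ln (2 * pi / (real q * (a\<^sup>2 * x / 4)))) = 3 * T + Z - Q - 2 * A - X"
    using assms by (simp add: defs ln_mult ln_div ln_realpow ln8)
  finally have 3: "of_real (2 * pi / (real q * (a\<^sup>2 * x / 4))) ^ Suc k = exp ((of_nat k + 1) * (3 * T + Z - Q - 2 * A - X))"
    by (simp add: exp_of_nat_mult[symmetric] add.commute del: power_Suc)
  have 4: "complex_of_real (a * q) powr \<nu> = exp (\<nu> * (A + Q))"
    using assms by (subst powr_of_pos_real) (simp_all add: defs ln_mult)
  have 5: "of_nat p powr (\<nu> + k) = exp ((\<nu> + k) * P)"
    using powr_of_pos_real[of "real p" "\<nu> + k"] assms by (simp add: defs)
  have 6: "complex_of_real x powr (\<nu> / 2) = exp (\<nu> / 2 * X)"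
    using assms by (subst powr_of_pos_real) (simp_all add: defs)
  have 7: "2 powr (3 * \<nu> + k + 2) = exp ((3 * \<nu> + k + 2) * T)"
    using powr_of_pos_real[of 2 "3 * \<nu> + k + 2"] by (simp add: defs)
  have 8: "complex_of_real pi powr (2 * \<nu> + k + 1) = exp ((2 * \<nu> + k + 1) * Z)"
    by (subst powr_of_pos_real) (simp_all add: defs)
  have 9: "1 / of_nat p = exp (- P)" "1 / 2 = exp (- T)"
    using assms by (simp_all add: defs exp_minus exp_of_real inverse_eq_divide)
  have 10: "\<i> ^ Suc k = (-1) ^ (k div 2) * \<i>"
    using assms(1) by (elim evenE) (simp add: power_mult)
  have "1 / 2 / of_real (a * sqrt x / 2) powr \<nu> *
     (- (g / of_nat p * (of_real (2 * pi / (real q * (a\<^sup>2 * x / 4))) * \<i>) ^ Suc k)) *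
     of_real (a\<^sup>2 * p * q * x / (16 * pi\<^sup>2)) powr (\<nu> + k + 1)
    = (1 / 2) / of_real (a * sqrt x / 2) powr \<nu> * (1 / of_nat p) *
     of_real (2 * pi / (real q * (a\<^sup>2 * x / 4))) ^ Suc k *
     of_real (a\<^sup>2 * p * q * x / (16 * pi\<^sup>2)) powr (\<nu> + k + 1) * (- (\<i> ^ Suc k) * g)"
    unfolding power_mult_distrib by (simp only: divide_inverse mult_minus_left mult_minus_right mult_ac mult_1_left)
  also have "\<dots> = exp (- T) / exp (\<nu> * (A + X / 2 - T)) * exp (- P) * exp ((of_nat k + 1) * (3 * T + Z - Q - 2 * A - X)) *
      exp ((\<nu> + k + 1) * (2 * A + P + Q + X - 4 * T - 2 * Z)) * (- (\<i> ^ Suc k) * g)"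
    unfolding 1 2 3 9 ..
  also have "exp (- T) / exp (\<nu> * (A + X / 2 - T)) * exp (- P) * exp ((of_nat k + 1) * (3 * T + Z - Q - 2 * A - X)) *
      exp ((\<nu> + k + 1) * (2 * A + P + Q + X - 4 * T - 2 * Z)) =
     exp (\<nu> * (A + Q)) * exp ((\<nu> + k) * P) * exp (\<nu> / 2 * X) / (exp ((3 * \<nu> + k + 2) * T) * exp ((2 * \<nu> + k + 1) * Z))"
    unfolding exp_add[symmetric] exp_diff[symmetric]
    by (rule arg_cong[where f = exp]) (simp add: algebra_simps)
  also have "\<dots> * (- (\<i> ^ Suc k) * g) =
     (-1) ^ (k div 2) * exp (\<nu> * (A + Q)) * exp ((\<nu> + k) * P) * exp (\<nu> / 2 * X)
       / (\<i> * exp ((3 * \<nu> + k + 2) * T) * exp ((2 * \<nu> + k + 1) * Z)) * g"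
  proof -
    have "u1 * u2 * u3 / (v * w) * (- (m * \<i>) * g) = m * u1 * u2 * u3 / (\<i> * v * w) * g" for u1 u2 u3 v w m :: complex
      by (simp add: divide_inverse)
    thus ?thesis unfolding 10 .
  qed
  finally show ?thesis unfolding 4 5 6 7 8 .
qed

theorem theorem2p16:
  fixes k p q :: nat and chi1 chi2 :: "nat \<Rightarrow> complex" and a x :: real and \<nu> :: complex
  assumes "even k"
    and "primitive_char p chi1" and "primitive_char q chi2"
    and "(even_char p chi1 \<and> \<not> principal_char p chi1 \<and> odd_char q chi2) \<or>
         (odd_char p chi1 \<and> even_char q chi2 \<and> \<not> principal_char q chi2)"
    and "a > 0" and "x > 0" and "Re \<nu> > 0"
  shows "summable (\<lambda>m. sigma_chi (of_nat k) chi1 chi2 (Suc m) * of_nat (Suc m) powr (\<nu> / 2)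
                        * besselK \<nu> (a * sqrt (real (Suc m) * x)))
       \<and> summable (\<lambda>m. sigma_chi (of_nat k) (cnj \<circ> chi2) (cnj \<circ> chi1) (Suc m)
                        / complex_of_real (real (Suc m) + a\<^sup>2 * p * q * x / (16 * pi\<^sup>2)) powr (\<nu> + k + 1))
       \<and> (\<Sum>m. sigma_chi (of_nat k) chi1 chi2 (Suc m) * of_nat (Suc m) powr (\<nu> / 2)
                        * besselK \<nu> (a * sqrt (real (Suc m) * x)))
         = (-1) ^ (k div 2) * complex_of_real (a * q) powr \<nu> * of_nat p powr (\<nu> + k)
             * complex_of_real x powr (\<nu> / 2)
           / (\<i> * 2 powr (3 * \<nu> + k + 2) * complex_of_real pi powr (2 * \<nu> + k + 1))
           * gauss_sum p chi1 * gauss_sum q chi2 * Gamma (\<nu> + k + 1)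
           * (\<Sum>m. sigma_chi (of_nat k) (cnj \<circ> chi2) (cnj \<circ> chi1) (Suc m)
                        / complex_of_real (real (Suc m) + a\<^sup>2 * p * q * x / (16 * pi\<^sup>2)) powr (\<nu> + k + 1))"
proof -
  note prim = assms(2,3) and a = assms(5) and x = assms(6) and \<nu> = assms(7)
  note chi = primitive_imp_dirichlet[OF prim(1)] primitive_imp_dirichlet[OF prim(2)]
  note chi' = dirichlet_char_cnj[OF chi(1)] dirichlet_char_cnj[OF chi(2)]
  have np: "\<not> principal_char p chi1" "\<not> principal_char q chi2"
    using assms(4) odd_char_not_principal chi by blast+
  obtain \<epsilon> where \<epsilon>: "chi1 (p - 1) = \<epsilon>" "chi2 (q - 1) = - \<epsilon>" "\<epsilon> = 1 \<or> \<epsilon> = -1"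
    using assms(4) by (auto simp: even_char_def odd_char_def)
  have pq: "p > 0" "q > 0" using dirichlet_char_modulus_pos chi by blast+
  define c where "c = a\<^sup>2 * x / 4"
  define X where "X = a\<^sup>2 * p * q * x / (16 * pi\<^sup>2)"
  define s where "s = \<nu> + k + 1"
  have c: "c > 0" and X: "X > 0" unfolding c_def X_def using a x pq by simp_all
  have s: "Re s > real k + 1" unfolding s_def using \<nu> by simp
  define C where "C = 1 / 2 / of_real (a * sqrt x / 2) powr \<nu>"
  define D where "D = - (gauss_sum p chi1 * gauss_sum q chi2 / of_nat p * (of_real (2 * pi / (real q * c)) * \<i>) ^ Suc k)"
  define J where "J = (\<integral>v. of_real (exp (- exp v)) * exp (s * of_real v) * eisenstein k (cnj \<circ> chi2) (cnj \<circ> chi1) (exp v / X) \<partial>lborel)"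
  let ?L = "\<lambda>m. sigma_chi (of_nat k) chi1 chi2 (Suc m) * of_nat (Suc m) powr (\<nu> / 2) * besselK \<nu> (a * sqrt (real (Suc m) * x))"
  let ?R = "\<lambda>m. sigma_chi (of_nat k) (cnj \<circ> chi2) (cnj \<circ> chi1) (Suc m) / complex_of_real (real (Suc m) + X) powr s"

  have L_eq: "?L m = C * (sigma_chi (of_nat k) chi1 chi2 (Suc m) *
      (\<integral>v. of_real (exp (- exp v - real (Suc m) * c * exp (- v))) * exp (\<nu> * of_real v) \<partial>lborel))" for m
  proof -
    define n where "n = real (Suc m)"
    have n: "n > 0" by (simp add: n_def)
    have z: "a * sqrt (n * x) > 0" using a x n by simp
    have z2: "(a * sqrt (n * x))\<^sup>2 / 4 = n * c"
      using x n by (simp add: power_mult_distrib c_def)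
    have "of_real (a * sqrt (n * x) / 2) powr \<nu> = of_real (a * sqrt x / 2) powr \<nu> * of_real n powr (\<nu> / 2)"
      using a x n by (subst (1 2 3) powr_of_pos_real)
        (simp_all add: ln_mult ln_div ln_sqrt real_sqrt_mult algebra_simps flip: exp_add)
    moreover have "of_real n powr (\<nu> / 2) \<noteq> 0" using n by simp
    ultimately have C_eq: "of_real n powr (\<nu> / 2) * (1 / 2 / of_real (a * sqrt (n * x) / 2) powr \<nu>) = C"
      unfolding C_def by simp
    have n_eq: "of_nat (Suc m) = complex_of_real n" by (simp add: n_def)
    show ?thesis
      unfolding n_eq n_def[symmetric] besselK_integral[OF \<nu> z] z2 C_eq[symmetric] by (simp only: mult_ac)
  qed
  have "?L sums (C * (\<integral>v. of_real (exp (- exp v)) * exp (\<nu> * of_real v) * eisenstein k chi1 chi2 (c * exp (- v)) \<partial>lborel))"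
    unfolding L_eq by (intro sums_mult bessel_series_integral[OF chi \<nu> c])
  also have "(\<lambda>v. of_real (exp (- exp v)) * exp (\<nu> * of_real v) * eisenstein k chi1 chi2 (c * exp (- v))) =
      (\<lambda>v. D * (of_real (exp (- exp v)) * exp (s * of_real v) * eisenstein k (cnj \<circ> chi2) (cnj \<circ> chi1) (exp v / X)))"
  proof
    fix v :: real
    have arg: "4 * pi\<^sup>2 / (real p * real q * (c * exp (- v))) = exp v / X"
      using a x pq by (simp add: c_def X_def exp_minus field_simps)
    have "(of_real (2 * pi / (real q * (c * exp (- v)))) * \<i>) ^ Suc k =
        (of_real (2 * pi / (real q * c)) * \<i>) ^ Suc k * exp (of_nat (Suc k) * of_real v)"
      unfolding exp_of_nat_mult power_mult_distrib[symmetric] by (simp add: exp_minus exp_of_real field_simps del: power_Suc)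
    hence "eisenstein k chi1 chi2 (c * exp (- v)) =
        D * exp (of_nat (Suc k) * of_real v) * eisenstein k (cnj \<circ> chi2) (cnj \<circ> chi1) (exp v / X)"
      using eisenstein_transformation[OF assms(1) prim np \<epsilon>, of "c * exp (- v)"] c
      unfolding arg D_def by (simp add: mult_ac del: power_Suc of_nat_Suc)
    moreover have "exp (\<nu> * of_real v) * exp (of_nat (Suc k) * of_real v) = exp (s * of_real v)"
      by (simp add: s_def algebra_simps flip: exp_add)
    ultimately show "of_real (exp (- exp v)) * exp (\<nu> * of_real v) * eisenstein k chi1 chi2 (c * exp (- v)) =
      D * (of_real (exp (- exp v)) * exp (s * of_real v) * eisenstein k (cnj \<circ> chi2) (cnj \<circ> chi1) (exp v / X))"
      by (simp add: mult_ac)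
  qed
  also have "(\<integral>v. D * (of_real (exp (- exp v)) * exp (s * of_real v) * eisenstein k (cnj \<circ> chi2) (cnj \<circ> chi1) (exp v / X)) \<partial>lborel) = D * J"
    unfolding J_def by (rule integral_mult_right_zero)
  finally have L: "?L sums (C * (D * J))" .

  have nz: "Gamma s * of_real X powr s \<noteq> 0"
  proof -
    have "s \<notin> \<int>\<^sub>\<le>\<^sub>0" using s by (auto simp: nonpos_Ints_def)
    thus ?thesis using X by (simp add: Gamma_eq_zero_iff)
  qed
  have "(\<lambda>n. sigma_chi (of_nat k) (cnj \<circ> chi2) (cnj \<circ> chi1) (Suc n) * (Gamma s / of_real (1 + real (Suc n) / X) powr s)) sums J"
    unfolding J_def by (rule gamma_series_integral[OF chi'(2,1) s X])
  also have "(\<lambda>n. sigma_chi (of_nat k) (cnj \<circ> chi2) (cnj \<circ> chi1) (Suc n) * (Gamma s / of_real (1 + real (Suc n) / X) powr s)) =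
      (\<lambda>n. Gamma s * of_real X powr s * ?R n)"
  proof
    fix n
    define N where "N = real (Suc n)"
    have N: "N > 0" by (simp add: N_def)
    have "1 + N / X = (N + X) / X" using X by (simp add: field_simps)
    hence "of_real (N + X) powr s = of_real X powr s * of_real (1 + N / X) powr s"
      using X N by (subst (1 2 3) powr_of_pos_real) (simp_all add: ln_div algebra_simps flip: exp_add)
    thus "sigma_chi (of_nat k) (cnj \<circ> chi2) (cnj \<circ> chi1) (Suc n) * (Gamma s / of_real (1 + real (Suc n) / X) powr s) =
        Gamma s * of_real X powr s * ?R n"
      unfolding N_def[symmetric] using nz by simp
  qed
  finally have "(\<lambda>n. Gamma s * of_real X powr s * ?R n / (Gamma s * of_real X powr s)) sums (J / (Gamma s * of_real X powr s))"
    by (rule sums_divide)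
  hence R: "?R sums (J / (Gamma s * of_real X powr s))"
    unfolding nonzero_mult_div_cancel_left[OF nz] .
  have "suminf ?L = C * (D * J)" using L by (simp add: sums_iff)
  also have "\<dots> = (C * D * of_real X powr s) * Gamma s * suminf ?R"
    using R nz by (simp add: sums_iff)
  also have "C * D * of_real X powr s = (-1) ^ (k div 2) * complex_of_real (a * q) powr \<nu> * of_nat p powr (\<nu> + k)
             * complex_of_real x powr (\<nu> / 2)
           / (\<i> * 2 powr (3 * \<nu> + k + 2) * complex_of_real pi powr (2 * \<nu> + k + 1))
           * (gauss_sum p chi1 * gauss_sum q chi2)"
    unfolding C_def D_def X_def c_def s_def by (rule transformation_constant[OF assms(1) a x pq])
  finally have "suminf ?L = (-1) ^ (k div 2) * complex_of_real (a * q) powr \<nu> * of_nat p powr (\<nu> + k)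
             * complex_of_real x powr (\<nu> / 2)
           / (\<i> * 2 powr (3 * \<nu> + k + 2) * complex_of_real pi powr (2 * \<nu> + k + 1))
           * gauss_sum p chi1 * gauss_sum q chi2 * Gamma s * suminf ?R"
    by (simp only: mult.assoc)
  with sums_summable[OF L] sums_summable[OF R] show ?thesis
    unfolding s_def X_def by blast
qed

end
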